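(* Let $d\in\mathbb{N}=\{1,2,\ldots\}$ and let $\mu$ be a probability distribution on $\mathbb{Z}^d$ with characteristic function $\widehat{\mu}$. Then the following are equivalent: (i) $\widehat{\mu}(z)\neq 0$ for all $z\in\mathbb{R}^d$. (ii) There exist $k\in\mathbb{Z}^d$ and a finite signed measure $\nu$ on $\mathbb{R}^d$ with support contained in $\mathbb{Z}^d\setminus\{0\}$ such that $$\widehat{\mu}(z)=\exp\left\{ i\langle k,z\rangle+\int_{\mathbb{R}^d}\left(e^{i\langle z,x\rangle}-1\right)\,\nu(dx)\right\}\quad\text{for all } z\in\mathbb{R}^d.$$ (iii) There exist $k\in\mathbb{Z}^d$ and two compound Poisson distributions $\mu_1$ and $\mu_2$ on $\mathbb{R}^d$ with jump size distribution supported in $\mathbb{Z}^d\setminus\{0\}$ such that $$\widehat{\mu}(z)=e^{i\langle k,z\rangle}\,\frac{\widehat{\mu}_1(z)}{\widehat{\mu}_2(z)}\quad\text{for all } z\in\mathbb{R}^d.$$ (iv) There exist two infinitely divisible distributions $\mu_3$ and $\mu_4$ on $\mathbb{R}^d$ such that $\widehat{\mu}(z)=\widehat{\mu}_3(z)/\widehat{\mu}_4(z)$ for all $z\in\mathbb{R}^d$.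
   Context: A probability distribution on $\mathbb{Z}^d$ is viewed as a Borel probability measure on $\mathbb{R}^d$ concentrated on $\mathbb{Z}^d$. Measures and signed measures on $\mathbb{R}^d$ are defined on the Borel $\sigma$-algebra; a finite signed measure is real-valued. The characteristic function of a probability measure $\mu$ on $\mathbb{R}^d$ is $\widehat{\mu}(z)=\int_{\mathbb{R}^d} e^{i\langle z,x\rangle}\,\mu(dx)$, $z\in\mathbb{R}^d$, where $\langle z,x\rangle=z^Tx$ is the Euclidean inner product. A probability distribution $\mu$ on $\mathbb{R}^d$ is infinitely divisible if for every $n\in\mathbb{N}$ there exists a probability distribution $\mu_n$ on $\mathbb{R}^d$ such that $\mu=\mu_n^{\ast n}$ (the $n$-fold convolution of $\mu_n$ with itself). A distribution $\mu$ on $\mathbb{R}^d$ is a compound Poisson distribution with jump size distribution $\sigma$, where $\sigma$ is a probability measure on $\mathbb{R}^d\setminus\{0\}$, if there is some $\lambda>0$ such that $\widehat{\mu}(z)=\exp\{\int_{\mathbb{R}^d}(e^{i\langle z,x\rangle}-1)\,\lambda\,\sigma(dx)\}$ for all $z\in\mathbb{R}^d$. *)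

theory Defs
  imports "HOL-Probability.Probability"
begin

definition integer_lattice :: "(real ^ 'd) set" where
  "integer_lattice = {x. \<forall>i. x $ i \<in> \<int>}"

definition prob_distribution :: "'a::topological_space measure \<Rightarrow> bool" where
  "prob_distribution \<mu> \<longleftrightarrow> prob_space \<mu> \<and> sets \<mu> = sets borel"

(* The library's char is restricted to measures on the real line. *)
definition char_fun :: "'a::euclidean_space measure \<Rightarrow> 'a \<Rightarrow> complex" where
  "char_fun \<mu> z = (CLINT x|\<mu>. iexp (z \<bullet> x))"

primrec conv_power :: "'a::ordered_euclidean_space measure \<Rightarrow> nat \<Rightarrow> 'a measure" where
  "conv_power \<mu> 0 = return borel 0"
| "conv_power \<mu> (Suc n) = convolution \<mu> (conv_power \<mu> n)"

definition infinitely_divisible :: "'a::ordered_euclidean_space measure \<Rightarrow> bool" where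
  "infinitely_divisible \<mu> \<longleftrightarrow> prob_distribution \<mu> \<and>
     (\<forall>n\<ge>1. \<exists>\<mu>\<^sub>n. prob_distribution \<mu>\<^sub>n \<and> \<mu> = conv_power \<mu>\<^sub>n n)"

(* A probability measure on the space without the origin is identified with a
   Borel probability measure on the whole space that does not charge the origin. *)
definition compound_poisson ::
    "'a::euclidean_space measure \<Rightarrow> 'a measure \<Rightarrow> bool" where
  "compound_poisson \<mu> \<sigma> \<longleftrightarrow>
     prob_distribution \<mu> \<and> prob_distribution \<sigma> \<and> emeasure \<sigma> {0} = 0 \<and>
     (\<exists>l>0. \<forall>z. char_fun \<mu> z =
        exp (CLINT x|scale_measure (ennreal l) \<sigma>. iexp (z \<bullet> x) - 1))"

definition measure_support :: "'a::topological_space measure \<Rightarrow> 'a set" where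
  "measure_support M = {x. \<forall>U. open U \<and> x \<in> U \<longrightarrow> emeasure M U > 0}"

(* A finite signed measure is a real-valued set function; only its values on Borel
   sets matter. *)
definition finite_signed_measure :: "('a::topological_space set \<Rightarrow> real) \<Rightarrow> bool" where
  "finite_signed_measure \<nu> \<longleftrightarrow> \<nu> {} = 0 \<and>
     (\<forall>A :: nat \<Rightarrow> 'a set. range A \<subseteq> sets borel \<and> disjoint_family A \<longrightarrow>
        (\<lambda>i. \<nu> (A i)) sums \<nu> (\<Union>i. A i))"

(* Jordan decomposition: the upper variation of A is the supremum of the values of the
   signed measure on the Borel subsets of A. It is nonnegative because of the empty set,
   so the truncation at 0 performed by ennreal does not change the supremum. *)
definition positive_part :: "('a::topological_space set \<Rightarrow> real) \<Rightarrow> 'a measure" where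
  "positive_part \<nu> =
     measure_of UNIV (sets borel) (\<lambda>A. SUP B\<in>{B \<in> sets borel. B \<subseteq> A}. ennreal (\<nu> B))"

definition negative_part :: "('a::topological_space set \<Rightarrow> real) \<Rightarrow> 'a measure" where
  "negative_part \<nu> = positive_part (\<lambda>A. - \<nu> A)"

definition total_variation :: "('a::topological_space set \<Rightarrow> real) \<Rightarrow> 'a measure" where
  "total_variation \<nu> = measure_of UNIV (sets borel)
     (\<lambda>A. emeasure (positive_part \<nu>) A + emeasure (negative_part \<nu>) A)"

definition signed_support :: "('a::topological_space set \<Rightarrow> real) \<Rightarrow> 'a set" where
  "signed_support \<nu> = measure_support (total_variation \<nu>)"

definition signed_integral ::
    "('a::topological_space set \<Rightarrow> real) \<Rightarrow> ('a \<Rightarrow> complex) \<Rightarrow> complex" where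
  "signed_integral \<nu> f = (CLINT x|positive_part \<nu>. f x) - (CLINT x|negative_part \<nu>. f x)"

end

theory Submission
  imports Defs
begin

text \<open>The substantial implication is that a zero-free characteristic function \<open>\<phi>\<close> of a
  distribution on \<open>\<int>\<^sup>d\<close> has an exponent of the required form. Such a \<open>\<phi>\<close> is an absolutely convergent
  Fourier series. As \<open>\<real>\<^sup>d\<close> is contractible, \<open>\<phi>\<close> has a continuous logarithm, and subtracting a linear
  function \<open>\<i> \<langle>k, z\<rangle>\<close> with \<open>k \<in> \<int>\<^sup>d\<close> makes it a periodic function \<open>h\<close>. By Stone--Weierstrass on the torus,
  \<open>h\<close> is uniformly close to a trigonometric polynomial \<open>Q\<close>, so \<open>e\<^bsup>h - Q\<^esup>\<close> is an absolutely convergent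
  Fourier series uniformly close to 1. Since the spectral radius in the Wiener algebra is the
  supremum norm, its logarithm \<open>h - Q\<close> is again in the algebra, and so is \<open>h\<close>. The Fourier
  coefficients of \<open>h\<close> are real because \<open>\<phi>(-z)\<close> is the conjugate of \<open>\<phi>(z)\<close>. Their positive and negative parts
  provide the signed measure, the two compound Poisson laws and the two infinitely divisible laws.
  Conversely, infinitely divisible laws have no zeros in their characteristic functions.\<close>

(* Both theories of infinite sums use this notation. *)
no_notation Infinite_Set_Sum.abs_summable_on (infix \<open>abs'_summable'_on\<close> 50)

section \<open>The Wiener algebra\<close>

text \<open>The obstacle is a mismatch of norms. Approximation makes \<open>exp (h - Q)\<close>
  close to 1 only in the supremum norm, while the logarithm series must converge in the sum of
  absolute values of the coefficients. The bridge is elementary: averaging over translates bounds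
  every single coefficient of a trigonometric polynomial by its supremum norm, and powers of such a
  polynomial have few frequencies. The same coefficient bound later shows that a discrete law is
  determined by its characteristic function, which is how convolution roots of compound Poisson laws
  are recognised. The algebra norm is encoded as a predicate: \<open>wiener r f\<close> asks for
  some representing coefficients of total size at most \<open>r\<close>. Every closure property thus
  carries an explicit bound, and a series of functions is handled by summing these bounds.\<close>

definition wiener :: "real \<Rightarrow> (real ^ 'd \<Rightarrow> complex) \<Rightarrow> bool" where
  "wiener r f \<longleftrightarrow> (\<exists>c. c abs_summable_on integer_lattice \<and>
     (\<Sum>\<^sub>\<infinity>k\<in>integer_lattice. norm (c k)) \<le> r \<and>
     (\<forall>z. f z = (\<Sum>\<^sub>\<infinity>k\<in>integer_lattice. c k * iexp (z \<bullet> k))))"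

text \<open>Frequencies may repeat in the family. Adding up the coefficients that share a frequency
  can only decrease the total absolute value, by the triangle inequality. Products (pairs with
  frequency \<open>fst p + snd p\<close>) and series (pairs of term number and frequency) are
  reduced to this regrouping.\<close>

lemma wiener_family:
  fixes a :: "'i \<Rightarrow> complex" and \<kappa> :: "'i \<Rightarrow> real ^ 'd"
  assumes a: "a abs_summable_on I" and \<kappa>: "\<kappa> ` I \<subseteq> integer_lattice"
    and r: "(\<Sum>\<^sub>\<infinity>i\<in>I. norm (a i)) \<le> r"
    and f: "\<And>z. f z = (\<Sum>\<^sub>\<infinity>i\<in>I. a i * iexp (z \<bullet> \<kappa> i))"
  shows "wiener r f"
proof -
  let ?L = "integer_lattice :: (real ^ 'd) set"
  define S where "S = Sigma ?L (\<lambda>k. {i\<in>I. \<kappa> i = k})"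
  have bij: "bij_betw snd S I"
    using \<kappa> by (auto simp: S_def bij_betw_def inj_on_def image_iff)
  define c where "c k = (\<Sum>\<^sub>\<infinity>i\<in>{i\<in>I. \<kappa> i = k}. a i)" for k
  have summ: "(\<lambda>p. a (snd p)) abs_summable_on S"
    using a summable_on_reindex_bij_betw[OF bij, of "\<lambda>i. norm (a i)"] by simp
  have inner: "a abs_summable_on {i\<in>I. \<kappa> i = k}" for k
    using a by (rule summable_on_subset_banach) auto
  have outer: "(\<lambda>k. \<Sum>\<^sub>\<infinity>i\<in>{i\<in>I. \<kappa> i = k}. norm (a i)) summable_on ?L"
    by (rule summable_on_Sigma_banach) (use summ in \<open>simp add: S_def split_def\<close>)
  have le: "norm (c k) \<le> (\<Sum>\<^sub>\<infinity>i\<in>{i\<in>I. \<kappa> i = k}. norm (a i))" for k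
    unfolding c_def by (rule norm_infsum_bound[OF inner])
  have c: "c abs_summable_on ?L"
    by (rule summable_on_comparison_test[OF outer]) (use le in auto)
  have "(\<Sum>\<^sub>\<infinity>k\<in>?L. norm (c k)) \<le> (\<Sum>\<^sub>\<infinity>k\<in>?L. \<Sum>\<^sub>\<infinity>i\<in>{i\<in>I. \<kappa> i = k}. norm (a i))"
    by (rule infsum_mono[OF c outer]) (rule le)
  also have "\<dots> = (\<Sum>\<^sub>\<infinity>p\<in>S. norm (a (snd p)))"
    unfolding S_def using summ[unfolded S_def]
    by (subst infsum_Sigma_banach[symmetric]) (auto simp: case_prod_beta)
  also have "\<dots> = (\<Sum>\<^sub>\<infinity>i\<in>I. norm (a i))"
    by (rule infsum_reindex_bij_betw[OF bij])
  finally have le_r: "(\<Sum>\<^sub>\<infinity>k\<in>?L. norm (c k)) \<le> r" using r by simp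
  have fz: "f z = (\<Sum>\<^sub>\<infinity>k\<in>?L. c k * iexp (z \<bullet> k))" for z
  proof -
    have "(\<lambda>p. a (snd p) * iexp (z \<bullet> fst p)) abs_summable_on S"
      using summ by (simp add: norm_mult)
    then have s: "(\<lambda>p. a (snd p) * iexp (z \<bullet> fst p)) summable_on S"
      by (rule abs_summable_summable)
    have "f z = (\<Sum>\<^sub>\<infinity>p\<in>S. a (snd p) * iexp (z \<bullet> \<kappa> (snd p)))"
      unfolding f by (rule infsum_reindex_bij_betw[OF bij, symmetric])
    also have "\<dots> = (\<Sum>\<^sub>\<infinity>p\<in>S. a (snd p) * iexp (z \<bullet> fst p))"
      by (rule infsum_cong) (auto simp: S_def)
    also have "\<dots> = (\<Sum>\<^sub>\<infinity>k\<in>?L. \<Sum>\<^sub>\<infinity>i\<in>{i\<in>I. \<kappa> i = k}. a i * iexp (z \<bullet> k))"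
      using s unfolding S_def by (subst infsum_Sigma_banach[symmetric]) (auto simp: case_prod_beta)
    also have "\<dots> = (\<Sum>\<^sub>\<infinity>k\<in>?L. c k * iexp (z \<bullet> k))"
      unfolding c_def by (intro infsum_cong infsum_cmult_left)
        (use inner abs_summable_summable in blast)
    finally show ?thesis .
  qed
  show ?thesis unfolding wiener_def using c le_r fz by blast
qed

lemma wiener_mono: "wiener r f \<Longrightarrow> r \<le> s \<Longrightarrow> wiener s f"
  unfolding wiener_def using order_trans by blast

lemma wiener_norm_le:
  assumes "wiener r f" shows "norm (f z) \<le> r"
proof -
  obtain c where c: "c abs_summable_on integer_lattice"
    "(\<Sum>\<^sub>\<infinity>k\<in>integer_lattice. norm (c k)) \<le> r"
    "\<forall>z. f z = (\<Sum>\<^sub>\<infinity>k\<in>integer_lattice. c k * iexp (z \<bullet> k))"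
    using assms unfolding wiener_def by blast
  have "norm (f z) \<le> (\<Sum>\<^sub>\<infinity>k\<in>integer_lattice. norm (c k * iexp (z \<bullet> k)))"
    unfolding c(3)[rule_format] by (rule norm_infsum_bound) (use c(1) in \<open>simp add: norm_mult\<close>)
  then show ?thesis using c(2) by (simp add: norm_mult)
qed

lemma wiener_nonneg: "wiener r f \<Longrightarrow> 0 \<le> r"
  using wiener_norm_le norm_ge_zero order_trans by metis

lemma wiener_sum:
  assumes "finite I" "\<And>i. i \<in> I \<Longrightarrow> \<kappa> i \<in> integer_lattice" "(\<Sum>i\<in>I. norm (a i)) \<le> r"
  shows "wiener r (\<lambda>z. \<Sum>i\<in>I. a i * iexp (z \<bullet> \<kappa> i))"
  by (rule wiener_family[of a I \<kappa>]) (use assms in auto)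

lemma wiener_const: "wiener (norm a) (\<lambda>z. a)"
  using wiener_sum[of "{()}" "\<lambda>_. 0" "\<lambda>_. a" "norm a"] by (simp add: integer_lattice_def)

text \<open>This is completeness of the algebra in quantitative form: summable bounds make the
  double family of coefficients absolutely summable. It is applied to the exponential and the
  logarithm series.\<close>

lemma wiener_suminf:
  assumes f: "\<And>n::nat. wiener (r n) (f n)" and r: "summable r"
  shows "wiener (suminf r) (\<lambda>z. \<Sum>n. f n z)"
proof -
  let ?L = "integer_lattice :: (real ^ 'a) set"
  have "\<forall>n. \<exists>c. c abs_summable_on ?L \<and> (\<Sum>\<^sub>\<infinity>k\<in>?L. norm (c k)) \<le> r n \<and>
      (\<forall>z. f n z = (\<Sum>\<^sub>\<infinity>k\<in>?L. c k * iexp (z \<bullet> k)))"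
    using f unfolding wiener_def by blast
  then obtain c where "\<forall>n. c n abs_summable_on ?L \<and> (\<Sum>\<^sub>\<infinity>k\<in>?L. norm (c n k)) \<le> r n \<and>
      (\<forall>z. f n z = (\<Sum>\<^sub>\<infinity>k\<in>?L. c n k * iexp (z \<bullet> k)))"
    by (rule choice[THEN exE])
  then have c: "\<And>n. c n abs_summable_on ?L"
    "\<And>n. (\<Sum>\<^sub>\<infinity>k\<in>?L. norm (c n k)) \<le> r n"
    "\<And>n z. f n z = (\<Sum>\<^sub>\<infinity>k\<in>?L. c n k * iexp (z \<bullet> k))"
    by auto
  have r0: "r n \<ge> 0" for n using wiener_nonneg[OF f] .
  have rs: "r summable_on UNIV" using r r0
    by (simp add: summable_on_UNIV_nonneg_real_iff)
  have outer: "(\<lambda>n. \<Sum>\<^sub>\<infinity>k\<in>?L. norm (c n k)) summable_on UNIV"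
    by (rule summable_on_comparison_test[OF rs]) (use c(2) in \<open>auto intro: infsum_nonneg\<close>)
  define a where "a p = c (fst p) (snd p)" for p
  have a: "a abs_summable_on UNIV \<times> ?L"
    unfolding Infinite_Sum.abs_summable_on_Sigma_iff a_def using c(1) outer
    by (auto simp: abs_of_nonneg infsum_nonneg)
  show ?thesis
  proof (rule wiener_family[OF a, of snd])
    have "(\<Sum>\<^sub>\<infinity>p\<in>UNIV \<times> ?L. norm (a p)) = (\<Sum>\<^sub>\<infinity>n. \<Sum>\<^sub>\<infinity>k\<in>?L. norm (c n k))"
      using a by (subst infsum_Sigma_banach[symmetric]) (auto simp: a_def case_prod_beta)
    also have "\<dots> \<le> (\<Sum>\<^sub>\<infinity>n. r n)"
      by (rule infsum_mono[OF outer rs]) (rule c(2))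
    also have "\<dots> = suminf r"
      using has_sum_imp_sums[OF has_sum_infsum[OF rs]] by (simp add: sums_iff)
    finally show "(\<Sum>\<^sub>\<infinity>p\<in>UNIV \<times> ?L. norm (a p)) \<le> suminf r" .
    fix z
    have "(\<lambda>p. a p * iexp (z \<bullet> snd p)) abs_summable_on UNIV \<times> ?L"
      using a by (simp add: norm_mult)
    then have s: "(\<lambda>p. a p * iexp (z \<bullet> snd p)) summable_on UNIV \<times> ?L"
      by (rule abs_summable_summable)
    have "f n z = (\<Sum>\<^sub>\<infinity>k\<in>?L. a (n, k) * iexp (z \<bullet> snd (n, k)))" for n
      by (simp add: c(3) a_def)
    moreover have "(\<lambda>n. \<Sum>\<^sub>\<infinity>k\<in>?L. a (n, k) * iexp (z \<bullet> snd (n, k))) summable_on UNIV"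
      by (rule summable_on_Sigma_banach) (use s in \<open>simp add: split_def\<close>)
    ultimately have "(\<lambda>n. f n z) summable_on UNIV" by simp
    then have "(\<Sum>n. f n z) = (\<Sum>\<^sub>\<infinity>n. f n z)"
      using has_sum_imp_sums[OF has_sum_infsum] by (metis sums_iff)
    also have "\<dots> = (\<Sum>\<^sub>\<infinity>p\<in>UNIV \<times> ?L. a p * iexp (z \<bullet> snd p))"
      using s by (subst infsum_Sigma_banach[symmetric]) (auto simp: a_def c(3) case_prod_beta)
    finally show "(\<Sum>n. f n z) = (\<Sum>\<^sub>\<infinity>p\<in>UNIV \<times> ?L. a p * iexp (z \<bullet> snd p))" .
  qed auto
qed

lemma integer_lattice_add:
  "k \<in> integer_lattice \<Longrightarrow> l \<in> integer_lattice \<Longrightarrow> k + l \<in> integer_lattice"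
  by (simp add: integer_lattice_def)

lemma wiener_add:
  assumes "wiener r f" "wiener s g"
  shows "wiener (r + s) (\<lambda>z. f z + g z)"
proof -
  obtain c where c: "c abs_summable_on integer_lattice"
    "(\<Sum>\<^sub>\<infinity>k\<in>integer_lattice. norm (c k)) \<le> r"
    "\<forall>z. f z = (\<Sum>\<^sub>\<infinity>k\<in>integer_lattice. c k * iexp (z \<bullet> k))"
    using assms(1) unfolding wiener_def by blast
  obtain d where d: "d abs_summable_on integer_lattice"
    "(\<Sum>\<^sub>\<infinity>k\<in>integer_lattice. norm (d k)) \<le> s"
    "\<forall>z. g z = (\<Sum>\<^sub>\<infinity>k\<in>integer_lattice. d k * iexp (z \<bullet> k))"
    using assms(2) unfolding wiener_def by blast
  have sum: "(\<lambda>k. norm (c k) + norm (d k)) summable_on integer_lattice"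
    by (rule summable_on_add[OF c(1) d(1)])
  show ?thesis
  proof (rule wiener_family[of "\<lambda>k. c k + d k" integer_lattice "\<lambda>k. k"])
    show cd: "(\<lambda>k. c k + d k) abs_summable_on integer_lattice"
      by (rule summable_on_comparison_test[OF sum]) (auto intro: norm_triangle_ineq)
    have "(\<Sum>\<^sub>\<infinity>k\<in>integer_lattice. norm (c k + d k)) \<le>
      (\<Sum>\<^sub>\<infinity>k\<in>integer_lattice. norm (c k) + norm (d k))"
      by (rule infsum_mono[OF cd sum]) (rule norm_triangle_ineq)
    also have "\<dots> \<le> r + s" using c d by (simp add: infsum_add)
    finally show "(\<Sum>\<^sub>\<infinity>k\<in>integer_lattice. norm (c k + d k)) \<le> r + s" .
    fix z
    have "(\<lambda>k. c k * iexp (z \<bullet> k)) summable_on integer_lattice"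
      "(\<lambda>k. d k * iexp (z \<bullet> k)) summable_on integer_lattice"
      by (rule abs_summable_summable, use c d in \<open>simp add: norm_mult\<close>)+
    then show "f z + g z = (\<Sum>\<^sub>\<infinity>k\<in>integer_lattice. (c k + d k) * iexp (z \<bullet> k))"
      by (simp add: c(3) d(3) infsum_add ring_distribs)
  qed auto
qed

lemma wiener_mult:
  assumes "wiener r f" "wiener s g"
  shows "wiener (r * s) (\<lambda>z. f z * g z)"
proof -
  let ?L = "integer_lattice :: (real ^ 'a) set"
  obtain c where c: "c abs_summable_on ?L"
    "(\<Sum>\<^sub>\<infinity>k\<in>?L. norm (c k)) \<le> r"
    "\<forall>z. f z = (\<Sum>\<^sub>\<infinity>k\<in>?L. c k * iexp (z \<bullet> k))"
    using assms(1) unfolding wiener_def by blast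
  obtain d where d: "d abs_summable_on ?L"
    "(\<Sum>\<^sub>\<infinity>k\<in>?L. norm (d k)) \<le> s"
    "\<forall>z. g z = (\<Sum>\<^sub>\<infinity>k\<in>?L. d k * iexp (z \<bullet> k))"
    using assms(2) unfolding wiener_def by blast
  define a where "a p = c (fst p) * d (snd p)" for p
  have a: "a abs_summable_on ?L \<times> ?L"
    unfolding Infinite_Sum.abs_summable_on_Sigma_iff
    by (auto simp: a_def norm_mult infsum_cmult_right' infsum_nonneg c(1) d(1)
        intro!: summable_on_cmult_right summable_on_cmult_left)
  have prod: "(\<Sum>\<^sub>\<infinity>p\<in>?L \<times> ?L. u (fst p) * v (snd p)) = (\<Sum>\<^sub>\<infinity>k\<in>?L. u k) * (\<Sum>\<^sub>\<infinity>k\<in>?L. v k)"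
    if "(\<lambda>p. u (fst p) * v (snd p)) summable_on ?L \<times> ?L"
    for u v :: "real ^ 'a \<Rightarrow> 'b::{banach,real_normed_field}"
    using that by (subst infsum_Sigma_banach[symmetric])
      (auto simp: case_prod_beta infsum_cmult_right' infsum_cmult_left')
  show ?thesis
  proof (rule wiener_family[OF a, of "\<lambda>p. fst p + snd p"])
    show "(\<lambda>p. fst p + snd p) ` (?L \<times> ?L) \<subseteq> integer_lattice"
      by (auto intro: integer_lattice_add)
    have "(\<Sum>\<^sub>\<infinity>p\<in>?L \<times> ?L. norm (a p)) = (\<Sum>\<^sub>\<infinity>k\<in>?L. norm (c k)) * (\<Sum>\<^sub>\<infinity>k\<in>?L. norm (d k))"
      using prod[of "\<lambda>k. norm (c k)" "\<lambda>k. norm (d k)"] a by (simp add: a_def norm_mult)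
    also have "\<dots> \<le> r * s"
      by (intro mult_mono c d infsum_nonneg wiener_nonneg[OF assms(1)]) auto
    finally show "(\<Sum>\<^sub>\<infinity>p\<in>?L \<times> ?L. norm (a p)) \<le> r * s" .
    fix z
    have "(\<lambda>p. a p * iexp (z \<bullet> (fst p + snd p))) summable_on ?L \<times> ?L"
      by (rule abs_summable_summable) (use a in \<open>simp add: norm_mult\<close>)
    moreover have *: "a p * iexp (z \<bullet> (fst p + snd p)) =
        (c (fst p) * iexp (z \<bullet> fst p)) * (d (snd p) * iexp (z \<bullet> snd p))" for p
      by (simp add: a_def inner_add_right ring_distribs exp_add)
    ultimately show "f z * g z = (\<Sum>\<^sub>\<infinity>p\<in>?L \<times> ?L. a p * iexp (z \<bullet> (fst p + snd p)))"
      using prod[of "\<lambda>k. c k * iexp (z \<bullet> k)" "\<lambda>k. d k * iexp (z \<bullet> k)"]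
      by (simp add: c(3) d(3))
  qed
qed

lemma wiener_cmult: "wiener r f \<Longrightarrow> wiener (norm a * r) (\<lambda>z. a * f z)"
  using wiener_mult[OF wiener_const] by blast

lemma wiener_power:
  assumes "wiener r f" shows "wiener (r ^ n) (\<lambda>z. f z ^ n)"
proof (induction n)
  case 0 show ?case using wiener_const[of 1] by simp
next
  case (Suc n) then show ?case using wiener_mult[OF assms] by simp
qed

lemma wiener_finite_sum:
  assumes "finite I" "\<And>i. i \<in> I \<Longrightarrow> wiener (r i) (f i)"
  shows "wiener (\<Sum>i\<in>I. r i) (\<lambda>z. \<Sum>i\<in>I. f i z)"
  using assms
proof (induction I rule: finite_induct)
  case empty show ?case using wiener_const[of 0] by simp
next
  case (insert i I) then show ?case by (simp add: wiener_add)
qed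

lemma wiener_exp:
  assumes "wiener r f" shows "wiener (exp r) (\<lambda>z. exp (f z))"
proof -
  have "wiener (\<Sum>n. r ^ n /\<^sub>R fact n) (\<lambda>z. \<Sum>n. f z ^ n /\<^sub>R fact n)"
  proof (rule wiener_suminf)
    show "wiener (r ^ n /\<^sub>R fact n) (\<lambda>z. f z ^ n /\<^sub>R fact n)" for n
      using wiener_cmult[OF wiener_power[OF assms, of n], of "complex_of_real (inverse (fact n))"]
      by (simp add: scaleR_conv_of_real norm_inverse)
    show "summable (\<lambda>n. r ^ n /\<^sub>R fact n)" by (rule summable_exp_generic)
  qed
  then show ?thesis by (simp add: exp_def)
qed

section \<open>Trigonometric polynomials and the spectral radius\<close>

text \<open>Averaging a trigonometric polynomial with a suitable modulated translate annihilates a given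
  frequency \<open>l \<noteq> m\<close>, preserves the coefficient of \<open>m\<close> and does not increase the supremum norm.\<close>

lemma trig_poly_coeff_le:
  fixes c :: "'a::real_inner \<Rightarrow> complex"
  assumes "finite S" "m \<in> S" "\<And>z. norm (\<Sum>k\<in>S. c k * iexp (z \<bullet> k)) \<le> M"
  shows "norm (c m) \<le> M"
proof -
  have "norm (c m) \<le> M"
    if "finite T" "m \<notin> T" "\<And>z. norm (\<Sum>k\<in>insert m T. c k * iexp (z \<bullet> k)) \<le> M" for T c
    using that
  proof (induction T arbitrary: c rule: finite_induct)
    case empty
    from empty(2)[of 0] show ?case by simp
  next
    case (insert l T)
    \<comment> \<open>The scaling gives \<open>w \<bullet> (l - m) = pi\<close>, so
      \<open>1 + iexp (w \<bullet> (k - m))\<close> is 0 at \<open>k = l\<close> and 2 at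
      \<open>k = m\<close>; halving it therefore removes \<open>l\<close> and keeps the coefficient
      of \<open>m\<close>.\<close>
    define w where "w = (pi / (norm (l - m))\<^sup>2) *\<^sub>R (l - m)"
    have lm: "l \<noteq> m" "m \<notin> T" using insert.prems(1) by auto
    have w: "w \<bullet> (l - m) = pi"
      using lm by (simp add: w_def power2_norm_eq_inner)
    define c' where "c' k = c k * (1 + iexp (w \<bullet> (k - m))) / 2" for k
    have l0: "c' l = 0" by (simp add: c'_def w exp_pi_i mult.commute)
    have m0: "c' m = c m" by (simp add: c'_def)
    have "norm (\<Sum>k\<in>insert m T. c' k * iexp (z \<bullet> k)) \<le> M" for z
    proof -
      let ?p = "\<lambda>z. \<Sum>k\<in>insert m (insert l T). c k * iexp (z \<bullet> k)"
      have "(\<Sum>k\<in>insert m T. c' k * iexp (z \<bullet> k)) = (\<Sum>k\<in>insert m (insert l T). c' k * iexp (z \<bullet> k))"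
        using insert.hyps lm l0 by (simp add: insert_commute)
      also have "\<dots> = (?p z + iexp (- (w \<bullet> m)) * ?p (z + w)) / 2"
        unfolding sum_distrib_left sum.distrib[symmetric] sum_divide_distrib
        by (intro sum.cong refl)
          (simp add: c'_def inner_add_left inner_diff_right exp_add exp_diff exp_minus field_simps)
      also have "norm \<dots> \<le> (norm (?p z) + norm (?p (z + w))) / 2"
        by (simp add: norm_divide divide_right_mono norm_mult order_trans[OF norm_triangle_ineq])
      also have "\<dots> \<le> M" using insert.prems(2)[of z] insert.prems(2)[of "z + w"] by simp
      finally show ?thesis .
    qed
    from insert.IH[OF lm(2) this] show ?case by (simp add: m0)
  qed
  from this[of "S - {m}" c] assms show ?thesis by (simp add: insert_absorb)
qed

text \<open>The frequency set is a parameter because its cardinality enters the norm estimate for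
  powers.\<close>

definition trig_poly :: "'a set \<Rightarrow> ('a::real_inner \<Rightarrow> complex) \<Rightarrow> bool" where
  "trig_poly S f \<longleftrightarrow> (\<exists>c. \<forall>z. f z = (\<Sum>k\<in>S. c k * iexp (z \<bullet> k)))"

lemma trig_poly_family:
  assumes "finite I" "finite S" "\<kappa> ` I \<subseteq> S"
  shows "trig_poly S (\<lambda>z. \<Sum>i\<in>I. a i * iexp (z \<bullet> \<kappa> i))"
  unfolding trig_poly_def
proof (intro exI allI)
  fix z
  have "(\<Sum>i\<in>I. a i * iexp (z \<bullet> \<kappa> i)) =
      (\<Sum>k\<in>S. \<Sum>i\<in>{i\<in>I. \<kappa> i = k}. a i * iexp (z \<bullet> \<kappa> i))"
    by (rule sum.group[symmetric]) (use assms in auto)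
  also have "\<dots> = (\<Sum>k\<in>S. (\<Sum>i\<in>{i\<in>I. \<kappa> i = k}. a i) * iexp (z \<bullet> k))"
    by (simp add: sum_distrib_right)
  finally show "(\<Sum>i\<in>I. a i * iexp (z \<bullet> \<kappa> i)) =
    (\<Sum>k\<in>S. (\<Sum>i\<in>{i\<in>I. \<kappa> i = k}. a i) * iexp (z \<bullet> k))" .
qed

lemma trig_poly_mult:
  assumes "trig_poly S f" "trig_poly T g" "finite S" "finite T" "finite U"
    and "\<And>k l. k \<in> S \<Longrightarrow> l \<in> T \<Longrightarrow> k + l \<in> U"
  shows "trig_poly U (\<lambda>z. f z * g z)"
proof -
  obtain c d where c: "\<And>z. f z = (\<Sum>k\<in>S. c k * iexp (z \<bullet> k))"
    and d: "\<And>z. g z = (\<Sum>k\<in>T. d k * iexp (z \<bullet> k))"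
    using assms(1,2) unfolding trig_poly_def by blast
  have "f z * g z = (\<Sum>p\<in>S\<times>T. (c (fst p) * d (snd p)) * iexp (z \<bullet> (fst p + snd p)))" for z
    unfolding c d sum_product sum.cartesian_product
    by (intro sum.cong) (auto simp: inner_add_right ring_distribs exp_add)
  then show ?thesis
    using trig_poly_family[of "S \<times> T" U "\<lambda>p. fst p + snd p"] assms by fastforce
qed

text \<open>By \<open>trig_poly_coeff_le\<close>, each of the \<open>card S\<close> coefficients is
  at most the supremum bound \<open>M\<close>.\<close>

lemma trig_poly_wiener:
  assumes "trig_poly S f" "finite S" "S \<subseteq> integer_lattice" "\<And>z. norm (f z) \<le> M"
  shows "wiener (real (card S) * M) f"
proof -
  obtain c where c: "\<And>z. f z = (\<Sum>k\<in>S. c k * iexp (z \<bullet> k))"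
    using assms(1) unfolding trig_poly_def by blast
  have "norm (c m) \<le> M" if "m \<in> S" for m
    using trig_poly_coeff_le[OF assms(2) that] assms(4) c by metis
  then have "(\<Sum>k\<in>S. norm (c k)) \<le> real (card S) * M"
    using sum_bounded_above[of S "\<lambda>k. norm (c k)" M] by simp
  then show ?thesis
    using wiener_sum[of S "\<lambda>k. k" c] assms(2,3) c[abs_def] by auto
qed

lemma integer_lattice_combination:
  assumes "F \<subseteq> integer_lattice"
  shows "(\<Sum>k\<in>F. real (m k) *\<^sub>R k) \<in> integer_lattice"
  using assms by (auto simp: integer_lattice_def intro!: Ints_sum Ints_mult)

text \<open>The frequencies of the $n$-th power of a trigonometric polynomial are combinations of
  the original ones with multiplicities at most $n$, so their number grows polynomially; as each
  coefficient is bounded by the supremum norm, so does the quotient of the two norms.\<close>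

lemma trig_poly_power_wiener:
  assumes P: "trig_poly F P" and F: "finite F" "F \<subseteq> integer_lattice"
    and M: "\<And>z. norm (P z) \<le> M"
  shows "wiener (real (Suc n) ^ card F * M ^ n) (\<lambda>z. P z ^ n)"
proof -
  \<comment> \<open>Each multiplicity is bounded by \<open>n\<close> separately, instead of their
    sum being \<open>n\<close>. The index set is then a full box of functions with
    \<open>Suc n ^ card F\<close> elements, which is all the counting that the estimate
    requires.\<close>
  define S where "S n = (\<lambda>m. \<Sum>k\<in>F. real (m k) *\<^sub>R k) ` (F \<rightarrow>\<^sub>E {..n})" for n
  have fin: "finite (S n)" for n using F by (auto simp: S_def intro: finite_PiE)
  have card: "card (S n) \<le> Suc n ^ card F"
    using card_image_le[of "F \<rightarrow>\<^sub>E {..n}"] F by (simp add: S_def card_PiE finite_PiE)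
  have SL: "S n \<subseteq> integer_lattice"
    using integer_lattice_combination[OF F(2)] by (auto simp: S_def)
  have "trig_poly (S n) (\<lambda>z. P z ^ n)"
  proof (induction n)
    case 0
    have "trig_poly (S 0) (\<lambda>z. \<Sum>i\<in>{()}. 1 * iexp (z \<bullet> 0))"
    proof (rule trig_poly_family[OF _ fin])
      have "(\<lambda>k\<in>F. 0) \<in> F \<rightarrow>\<^sub>E {..0::nat}" by auto
      then have "(\<Sum>k\<in>F. real ((\<lambda>k\<in>F. 0) k) *\<^sub>R k) \<in> S 0" unfolding S_def by (rule imageI)
      then show "(\<lambda>_. 0) ` {()} \<subseteq> S 0" by simp
    qed simp
    then show ?case by simp
  next
    case (Suc n)
    have "trig_poly (S (Suc n)) (\<lambda>z. P z * P z ^ n)"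
    proof (rule trig_poly_mult[OF P Suc F(1) fin fin])
      fix k l assume k: "k \<in> F" and "l \<in> S n"
      then obtain m where m: "m \<in> F \<rightarrow>\<^sub>E {..n}" "l = (\<Sum>k\<in>F. real (m k) *\<^sub>R k)"
        by (auto simp: S_def)
      have "k + l = (\<Sum>j\<in>F. real ((m(k := Suc (m k))) j) *\<^sub>R j)"
        using k F(1) by (simp add: m(2) sum.remove[of F k] scaleR_left_distrib)
      moreover have "m(k := Suc (m k)) \<in> F \<rightarrow>\<^sub>E {..Suc n}"
        using m(1) k by (auto simp: PiE_def Pi_def extensional_def le_Suc_eq)
      ultimately show "k + l \<in> S (Suc n)" unfolding S_def by blast
    qed
    then show ?case by simp
  qed
  from trig_poly_wiener[OF this fin SL, of "M ^ n"]
  have "wiener (real (card (S n)) * M ^ n) (\<lambda>z. P z ^ n)"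
    using M by (simp add: norm_power power_mono)
  moreover have "0 \<le> M" using M[of 0] norm_ge_zero order_trans by metis
  ultimately show ?thesis
    using of_nat_mono[OF card, where 'a = real] by (elim wiener_mono) (intro mult_right_mono, simp_all)
qed

lemma summable_poly_geometric:
  fixes s :: real assumes "0 \<le> s" "s < 1"
  shows "summable (\<lambda>n. real (Suc n) ^ m * s ^ n)"
proof (cases "s = 0")
  case True
  then have "(\<lambda>n. real (Suc n) ^ m * s ^ n) = (\<lambda>n. if n = 0 then 1 else 0)" by auto
  then show ?thesis by (simp only: summable_If_finite) (use summable_finite[of "{0::nat}"] in simp)
next
  case False
  \<comment> \<open>The ratio of successive terms tends to \<open>s\<close>, so it is eventually
    below the midpoint of \<open>s\<close> and 1.\<close>
  define r where "r = (1 + s) / 2"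
  have r: "s < r" "r < 1" "0 < r" using assms by (auto simp: r_def)
  have "(\<lambda>n. (real (Suc (Suc n)) / real (Suc n)) ^ m * s) \<longlonglongrightarrow> 1 ^ m * s"
  proof (intro tendsto_intros)
    have "(\<lambda>n. 1 + 1 / real (Suc n)) \<longlonglongrightarrow> 1 + 0"
      by (intro tendsto_intros LIMSEQ_Suc[OF lim_1_over_n])
    moreover have "(\<lambda>n. 1 + 1 / real (Suc n)) = (\<lambda>n. real (Suc (Suc n)) / real (Suc n))"
      by (auto simp: divide_simps)
    ultimately show "(\<lambda>n. real (Suc (Suc n)) / real (Suc n)) \<longlonglongrightarrow> 1" by simp
  qed
  then have "eventually (\<lambda>n. (real (Suc (Suc n)) / real (Suc n)) ^ m * s < r) sequentially"
    using r by (intro order_tendstoD(2)) auto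
  then obtain N where N: "\<And>n. n \<ge> N \<Longrightarrow> (real (Suc (Suc n)) / real (Suc n)) ^ m * s < r"
    unfolding eventually_sequentially by blast
  show ?thesis
  proof (rule summable_ratio_test[OF r(2), of N])
    fix n assume "N \<le> n"
    have "norm (real (Suc (Suc n)) ^ m * s ^ Suc n)
      = ((real (Suc (Suc n)) / real (Suc n)) ^ m * s) * (real (Suc n) ^ m * s ^ n)"
      using assms by (simp add: abs_mult power_divide field_simps)
    also have "\<dots> \<le> r * (real (Suc n) ^ m * s ^ n)"
      using N[OF \<open>N \<le> n\<close>] assms by (intro mult_right_mono) auto
    also have "\<dots> = r * norm (real (Suc n) ^ m * s ^ n)" using assms by (simp add: abs_mult)
    finally show "norm (real (Suc (Suc n)) ^ m * s ^ Suc n) \<le> r * norm (real (Suc n) ^ m * s ^ n)" .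
  qed
qed

text \<open>Truncating the coefficient series leaves a remainder that is small in the algebra norm,
  not just in the supremum norm. This is what allows powers of the remainder to be bounded by powers
  of \<open>e\<close>.\<close>

lemma wiener_split:
  assumes "wiener r f" "0 < e"
  obtains F P R where "finite F" "F \<subseteq> integer_lattice" "trig_poly F P" "wiener e R" "\<And>z. f z = P z + R z"
proof -
  let ?L = "integer_lattice :: (real ^ 'a) set"
  obtain c where c: "c abs_summable_on ?L"
    "\<forall>z. f z = (\<Sum>\<^sub>\<infinity>k\<in>?L. c k * iexp (z \<bullet> k))"
    using assms(1) unfolding wiener_def by blast
  obtain F where F: "finite F" "F \<subseteq> ?L"
    "dist (\<Sum>k\<in>F. norm (c k)) (\<Sum>\<^sub>\<infinity>k\<in>?L. norm (c k)) \<le> e"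
    using infsum_finite_approximation[OF c(1) assms(2)] by blast
  have split: "infsum g ?L = (\<Sum>k\<in>F. g k) + infsum g (?L - F)" if "g summable_on ?L"
    for g :: "real ^ 'a \<Rightarrow> 'b::banach"
  proof -
    have "infsum g (F \<union> (?L - F)) = infsum g F + infsum g (?L - F)"
      using F(1) by (intro infsum_Un_disjoint summable_on_subset_banach[OF that]) (use F in auto)
    moreover have "F \<union> (?L - F) = ?L" using F by blast
    ultimately show ?thesis using F by simp
  qed
  have cL: "c abs_summable_on ?L - F" using c(1) by (rule summable_on_subset_banach) auto
  show ?thesis
  proof (rule that[of F "\<lambda>z. \<Sum>k\<in>F. c k * iexp (z \<bullet> k)" "\<lambda>z. \<Sum>\<^sub>\<infinity>k\<in>?L - F. c k * iexp (z \<bullet> k)"])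
    show "trig_poly F (\<lambda>z. \<Sum>k\<in>F. c k * iexp (z \<bullet> k))" unfolding trig_poly_def by blast
    show "wiener e (\<lambda>z. \<Sum>\<^sub>\<infinity>k\<in>?L - F. c k * iexp (z \<bullet> k))"
      using F(3) split[OF c(1)]
      by (intro wiener_family[OF cL, of "\<lambda>k. k"]) (auto simp: dist_norm)
    show "f z = (\<Sum>k\<in>F. c k * iexp (z \<bullet> k)) + (\<Sum>\<^sub>\<infinity>k\<in>?L - F. c k * iexp (z \<bullet> k))" for z
      unfolding c(2)[rule_format]
      by (rule split, rule abs_summable_summable) (use c(1) in \<open>simp add: norm_mult\<close>)
  qed (use F in auto)
qed

text \<open>The spectral radius in the Wiener algebra equals the supremum norm.\<close>

lemma wiener_power_summable:
  assumes f: "wiener r f" and s: "\<And>z. norm (f z) \<le> s" "s < 1"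
  obtains \<rho> where "summable \<rho>" "\<And>n. wiener (\<rho> n) (\<lambda>z. f z ^ n)"
proof -
  have s0: "0 \<le> s" using s(1)[of 0] norm_ge_zero order_trans by metis
  \<comment> \<open>The polynomial part has supremum norm at most \<open>s + e\<close> and the
    remainder has algebra norm at most \<open>e\<close>. Their total \<open>s + 2 * e\<close> equals
    \<open>1 - e\<close>, hence is still below 1.\<close>
  define e where "e = (1 - s) / 3"
  have e: "0 < e" "s + 2 * e < 1" using s(2) by (auto simp: e_def field_simps)
  obtain F P R where F: "finite F" "F \<subseteq> integer_lattice" and P: "trig_poly F P"
    and R: "wiener e R" and f_eq: "\<And>z. f z = P z + R z"
    using wiener_split[OF f e(1)] by metis
  have "norm (P z) \<le> s + e" for z
    using norm_triangle_ineq4[of "f z" "R z"] s(1)[of z] wiener_norm_le[OF R, of z] f_eq[of z] by simp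
  note Pn = trig_poly_power_wiener[OF P F this]
  show ?thesis
  proof (rule that)
    show "summable (\<lambda>n. real (Suc n) ^ card F * (s + 2 * e) ^ n)"
      using summable_poly_geometric e s0 by simp
    fix n
    have W: "wiener (\<Sum>k\<le>n. of_nat (n choose k) * ((real (Suc k) ^ card F * (s + e) ^ k) * e ^ (n - k)))
      (\<lambda>z. \<Sum>k\<le>n. of_nat (n choose k) * (P z ^ k * R z ^ (n - k)))"
    proof (rule wiener_finite_sum)
      fix k
      from wiener_cmult[OF wiener_mult[OF Pn[of k] wiener_power[OF R, of "n - k"]], of "of_nat (n choose k)"]
      show "wiener (of_nat (n choose k) * ((real (Suc k) ^ card F * (s + e) ^ k) * e ^ (n - k)))
        (\<lambda>z. of_nat (n choose k) * (P z ^ k * R z ^ (n - k)))" by simp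
    qed simp
    have eq: "(\<lambda>z. \<Sum>k\<le>n. of_nat (n choose k) * (P z ^ k * R z ^ (n - k))) = (\<lambda>z. f z ^ n)"
      by (simp add: f_eq binomial_ring mult.assoc)
    \<comment> \<open>Replacing the factor \<open>Suc k ^ card F\<close> by its largest value
      \<open>Suc n ^ card F\<close> lets the binomial theorem be applied backwards to what
      remains.\<close>
    have "(\<Sum>k\<le>n. of_nat (n choose k) * ((real (Suc k) ^ card F * (s + e) ^ k) * e ^ (n - k)))
      \<le> (\<Sum>k\<le>n. real (Suc n) ^ card F * (of_nat (n choose k) * (s + e) ^ k * e ^ (n - k)))"
    proof (rule sum_mono)
      fix k assume "k \<in> {..n}"
      then have "real (Suc k) ^ card F * (of_nat (n choose k) * (s + e) ^ k * e ^ (n - k))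
        \<le> real (Suc n) ^ card F * (of_nat (n choose k) * (s + e) ^ k * e ^ (n - k))"
        using s0 e by (intro mult_right_mono power_mono mult_nonneg_nonneg zero_le_power) auto
      then show "of_nat (n choose k) * ((real (Suc k) ^ card F * (s + e) ^ k) * e ^ (n - k))
        \<le> real (Suc n) ^ card F * (of_nat (n choose k) * (s + e) ^ k * e ^ (n - k))"
        by (simp add: mult_ac)
    qed
    also have "\<dots> = real (Suc n) ^ card F * (s + 2 * e) ^ n"
    proof -
      have "(s + e + e) ^ n = (\<Sum>k\<le>n. of_nat (n choose k) * (s + e) ^ k * e ^ (n - k))"
        by (rule binomial_ring)
      then show ?thesis by (simp add: sum_distrib_left[symmetric] add.assoc)
    qed
    finally show "wiener (real (Suc n) ^ card F * (s + 2 * e) ^ n) (\<lambda>z. f z ^ n)"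
      using W unfolding eq by (rule wiener_mono[rotated])
  qed
qed

text \<open>The function \<open>f - 1\<close> may be large in the algebra norm, but its powers have
  summable bounds by \<open>wiener_power_summable\<close>. The coefficients of the logarithm series
  have modulus at most 1, so the same bounds control the series.\<close>

lemma wiener_Ln:
  assumes f: "wiener r f" and s: "\<And>z. norm (f z - 1) \<le> s" "s < 1"
  shows "\<exists>r. wiener r (\<lambda>z. Ln (f z))"
proof -
  define g where "g z = f z - 1" for z
  have g: "wiener (r + 1) g"
    using wiener_add[OF f wiener_const[of "-1"]] by (simp add: g_def[abs_def])
  obtain \<rho> where \<rho>: "summable \<rho>" "\<And>n. wiener (\<rho> n) (\<lambda>z. g z ^ n)"
    using wiener_power_summable[OF g, of s] s by (auto simp: g_def)
  have "wiener (suminf \<rho>) (\<lambda>z. \<Sum>n. (-1) ^ Suc n / of_nat n * g z ^ n)"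
  proof (rule wiener_suminf[OF _ \<rho>(1)])
    fix n
    \<comment> \<open>For \<open>n = 0\<close> the coefficient is 0, because division by zero yields
      0; the logarithm series indeed has no constant term.\<close>
    have "norm ((-1) ^ Suc n / of_nat n :: complex) \<le> 1"
      by (cases n) (simp_all add: norm_divide norm_power norm_of_nat del: of_nat_Suc)
    then have "norm ((-1) ^ Suc n / of_nat n :: complex) * \<rho> n \<le> \<rho> n"
      using mult_right_mono wiener_nonneg[OF \<rho>(2)] by fastforce
    then show "wiener (\<rho> n) (\<lambda>z. (-1) ^ Suc n / of_nat n * g z ^ n)"
      using wiener_mono wiener_cmult[OF \<rho>(2)] by blast
  qed
  moreover have "(\<Sum>n. (-1) ^ Suc n / of_nat n * g z ^ n) = Ln (f z)" for z
    using Ln_series[of "g z"] s(1)[of z] s(2) by (simp add: sums_iff g_def)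
  ultimately show ?thesis by auto
qed

section \<open>Logarithms in the Wiener algebra\<close>

lemma iexp_2pi_lattice:
  assumes "k \<in> integer_lattice"
  shows "iexp ((z + (2 * pi) *\<^sub>R axis j 1) \<bullet> k) = iexp (z \<bullet> k)"
proof -
  obtain n where n: "k $ j = of_int n" using assms by (auto simp: integer_lattice_def Ints_def)
  have "iexp ((z + (2 * pi) *\<^sub>R axis j 1) \<bullet> k) = iexp (z \<bullet> k) * exp (2 * of_int n * of_real pi * \<i>)"
    by (simp add: inner_add_left inner_axis' n exp_add[symmetric] algebra_simps)
  then show ?thesis using exp_integer_2pi[of "of_int n"] by (simp add: mult_ac)
qed

lemma wiener_periodic:
  assumes "wiener r f" shows "f (z + (2 * pi) *\<^sub>R axis j 1) = f z"
  using assms unfolding wiener_def by (auto simp: iexp_2pi_lattice cong: infsum_cong)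

lemma wiener_continuous:
  assumes "wiener r f" shows "continuous_on UNIV f"
proof -
  have "\<exists>P. continuous_on UNIV P \<and> (\<forall>z. norm (f z - P z) \<le> e)" if e: "e > 0" for e
  proof -
    obtain F P R where F: "trig_poly F P" "wiener e R" "\<And>z. f z = P z + R z"
      using wiener_split[OF assms e] by metis
    have "continuous_on UNIV P"
      using F(1) unfolding trig_poly_def fun_eq_iff[symmetric] by (auto intro!: continuous_intros)
    moreover have "norm (f z - P z) \<le> e" for z
      using F(3) wiener_norm_le[OF F(2)] by simp
    ultimately show ?thesis by blast
  qed
  then have "\<forall>n. \<exists>P. continuous_on UNIV P \<and> (\<forall>z. norm (f z - P z) \<le> inverse (real (Suc n)))"
    by simp
  then obtain P where P: "\<And>n. continuous_on UNIV (P n)"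
    "\<And>n z. norm (f z - P n z) \<le> inverse (real (Suc n))" by metis
  show ?thesis
  proof (rule uniform_limit_theorem[of _ P])
    show "\<forall>\<^sub>F n in sequentially. continuous_on UNIV (P n)" using P by simp
    show "uniform_limit UNIV P f sequentially"
    proof (rule uniform_limitI)
      fix e :: real assume "e > 0"
      have "\<forall>\<^sub>F n in sequentially. inverse (real (Suc n)) < e"
        using order_tendstoD(2)[OF LIMSEQ_inverse_real_of_nat \<open>e > 0\<close>] .
      then show "\<forall>\<^sub>F n in sequentially. \<forall>z\<in>UNIV. dist (P n z) (f z) < e"
        by eventually_elim (use P(2) in \<open>auto simp: dist_norm norm_minus_commute intro: le_less_trans\<close>)
    qed
  qed simp
qed

section \<open>Periodic functions as functions on the torus\<close>

lemma periodic_integer_lattice: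
  fixes h :: "real ^ 'd \<Rightarrow> 'b"
  assumes per: "\<And>z j. h (z + (2 * pi) *\<^sub>R axis j 1) = h z" and l: "l \<in> integer_lattice"
  shows "h (z + (2 * pi) *\<^sub>R l) = h z"
proof -
  have nat: "h (z + (2 * pi * real n) *\<^sub>R axis j 1) = h z" for z j n
  proof (induction n)
    case (Suc n)
    have "z + (2 * pi * real (Suc n)) *\<^sub>R axis j 1 =
        (z + (2 * pi * real n) *\<^sub>R axis j 1) + (2 * pi) *\<^sub>R axis j 1"
      by (simp add: algebra_simps)
    then show ?case using Suc per by metis
  qed simp
  have int: "h (z + (2 * pi * of_int n) *\<^sub>R axis j 1) = h z" for z j n
  proof (cases "n \<ge> 0")
    case True
    then show ?thesis using nat[of z "nat n" j] by simp
  next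
    case False
    then show ?thesis
      using nat[of "z + (2 * pi * of_int n) *\<^sub>R axis j 1" "nat (- n)" j]
      by (simp add: algebra_simps)
  qed
  have "\<forall>j. \<exists>m::int. l $ j = of_int m" using l by (auto simp: integer_lattice_def Ints_def)
  then obtain m :: "'d \<Rightarrow> int" where m: "\<And>j. l $ j = of_int (m j)" by (auto dest: choice)
  have "h (z + (\<Sum>j\<in>J. (2 * pi * of_int (m j)) *\<^sub>R axis j 1)) = h z" if "finite J" for J
    using that
  proof (induction J rule: finite_induct)
    case (insert j J)
    have "z + (\<Sum>j\<in>insert j J. (2 * pi * of_int (m j)) *\<^sub>R axis j 1) =
        (z + (\<Sum>j\<in>J. (2 * pi * of_int (m j)) *\<^sub>R axis j 1)) + (2 * pi * of_int (m j)) *\<^sub>R axis j 1"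
      using insert by (simp add: algebra_simps)
    then show ?case by (simp only: int insert.IH)
  qed simp
  moreover have "(\<Sum>j\<in>UNIV. (2 * pi * of_int (m j)) *\<^sub>R axis j 1) = (2 * pi) *\<^sub>R l"
    by (simp add: vec_eq_iff m[symmetric] axis_def if_distrib cong: if_cong)
  ultimately show ?thesis by (metis finite_class.finite_UNIV)
qed

text \<open>The torus appears as a compact subset of a Euclidean space, so that polynomial
  approximation applies to functions on it. The real coordinates of the image point are the cosines
  and sines of the components of \<open>z\<close>, and polynomials in them are trigonometric
  polynomials.\<close>

definition torus_map :: "real ^ 'd \<Rightarrow> complex ^ 'd" where
  "torus_map z = (\<chi> j. cis (z $ j))"

lemma torus_map_eqD:
  assumes "torus_map z = torus_map z'"
  obtains l where "l \<in> integer_lattice" "z = z' + (2 * pi) *\<^sub>R l"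
proof -
  have "\<exists>n::int. z $ j = z' $ j + 2 * pi * of_int n" for j
  proof -
    have "exp (\<i> * of_real (z $ j)) = exp (\<i> * of_real (z' $ j))"
      using assms by (simp add: torus_map_def vec_eq_iff cis_conv_exp)
    then obtain n where "\<i> * of_real (z $ j) = \<i> * of_real (z' $ j) + (of_int (2 * n) * pi) * \<i>"
      unfolding exp_eq by blast
    then have "Im (\<i> * of_real (z $ j)) = Im (\<i> * of_real (z' $ j) + (of_int (2 * n) * pi) * \<i>)"
      by (rule arg_cong)
    then show ?thesis by (intro exI[of _ n]) simp
  qed
  then obtain m :: "'a \<Rightarrow> int" where "\<And>j. z $ j = z' $ j + 2 * pi * of_int (m j)" by metis
  then show ?thesis
    by (intro that[of "\<chi> j. of_int (m j)"]) (auto simp: integer_lattice_def vec_eq_iff)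
qed

lemma torus_map_box:
  obtains z' where "z' \<in> cbox 0 (\<chi> j. 2 * pi)" "torus_map z' = torus_map z"
proof -
  define n where "n j = \<lfloor>z $ j / (2 * pi)\<rfloor>" for j
  show ?thesis
  proof (rule that[of "\<chi> j. z $ j - 2 * pi * of_int (n j)"])
    have "of_int (n j) \<le> z $ j / (2 * pi)" "z $ j / (2 * pi) \<le> of_int (n j) + 1" for j
      unfolding n_def by linarith+
    then show "(\<chi> j. z $ j - 2 * pi * of_int (n j)) \<in> cbox 0 (\<chi> j. 2 * pi)"
      by (auto simp: mem_box_cart field_simps)
    have "cis (z $ j - 2 * pi * of_int (n j)) = cis (z $ j)" for j
      by (simp add: cis_divide[symmetric] cis_multiple_2pi)
    then show "torus_map (\<chi> j. z $ j - 2 * pi * of_int (n j)) = torus_map z"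
      by (simp add: torus_map_def vec_eq_iff)
  qed
qed

lemma wiener_polynomial_torus_map:
  assumes "real_polynomial_function q"
  shows "\<exists>r. wiener r (\<lambda>z. complex_of_real (q (torus_map z)))"
  using assms
proof (induction rule: real_polynomial_function.induct)
  case (linear f)
  interpret bounded_linear f by fact
  \<comment> \<open>A real-linear functional on the complex vectors is determined by its values at
    \<open>axis j 1\<close> and \<open>axis j \<i>\<close>, so it suffices to treat
    \<open>cos (z $ j)\<close> and \<open>sin (z $ j)\<close>, which are combinations of two
    characters each.\<close>
  have eq: "torus_map z = (\<Sum>j\<in>UNIV. cos (z $ j) *\<^sub>R axis j 1 + sin (z $ j) *\<^sub>R axis j \<i>)" for z :: "real ^ 'a"
    by (simp add: torus_map_def vec_eq_iff axis_def sum.distrib if_distrib cong: if_cong)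
      (simp add: complex_eq_iff)
  have char: "wiener 1 (\<lambda>z :: real ^ 'a. iexp (z \<bullet> k))" if "k \<in> integer_lattice" for k
    using wiener_sum[of "{()}" "\<lambda>_. k" "\<lambda>_. 1" 1] that by simp
  have axis: "axis j (1::real) \<in> integer_lattice" "- axis j (1::real) \<in> integer_lattice" for j :: 'a
    by (auto simp: integer_lattice_def axis_def)
  have cos: "wiener (norm (1/2::complex) * (1 + 1)) (\<lambda>z :: real ^ 'a. 1/2 * (iexp (z \<bullet> axis j 1) + iexp (z \<bullet> - axis j 1)))" for j
    by (intro wiener_cmult wiener_add char axis)
  have sin: "wiener (norm (1/(2*\<i>)) * (1 + norm (-1::complex) * 1)) (\<lambda>z :: real ^ 'a. 1/(2*\<i>) * (iexp (z \<bullet> axis j 1) + -1 * iexp (z \<bullet> - axis j 1)))" for j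
    by (intro wiener_cmult wiener_add char axis)
  have "wiener 1 (\<lambda>z :: real ^ 'a. of_real (cos (z $ j)))" "wiener 1 (\<lambda>z :: real ^ 'a. of_real (sin (z $ j)))" for j
    using cos[of j] sin[of j]
    by (simp_all add: inner_axis cos_of_real[symmetric] sin_of_real[symmetric] cos_exp_eq sin_exp_eq norm_divide norm_mult)
  then have "wiener (norm (complex_of_real a) * 1 + norm (complex_of_real b) * 1)
      (\<lambda>z :: real ^ 'a. of_real a * of_real (cos (z $ j)) + of_real b * of_real (sin (z $ j)))" for a b j
    by (intro wiener_add wiener_cmult)
  from wiener_finite_sum[OF finite_class.finite_UNIV this, of "\<lambda>j. f (axis j 1)" "\<lambda>j. f (axis j \<i>)" "\<lambda>j. j"]
  have "\<exists>r. wiener r (\<lambda>z :: real ^ 'a. \<Sum>j\<in>UNIV. of_real (f (axis j 1)) * of_real (cos (z $ j))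
      + of_real (f (axis j \<i>)) * of_real (sin (z $ j)))"
    by blast
  then show ?case
    by (simp add: eq sum add scaleR mult.commute)
next
  case (const c) then show ?case using wiener_const by blast
next
  case (add f g) then show ?case using wiener_add by fastforce
next
  case (mult f g) then show ?case using wiener_mult by fastforce
qed

lemma periodic_approx_wiener:
  fixes h :: "real ^ 'd \<Rightarrow> complex"
  assumes per: "\<And>z j. h (z + (2 * pi) *\<^sub>R axis j 1) = h z"
    and cont: "continuous_on UNIV h" and e: "e > 0"
  obtains r Q where "wiener r Q" "\<And>z. norm (h z - Q z) < e"
proof -
  let ?B = "cbox 0 (\<chi> j. 2 * pi) :: (real ^ 'd) set"
  \<comment> \<open>The function \<open>h\<close> descended to the torus. The choice of the preimage
    is harmless, since two preimages differ by a multiple of \<open>2 * pi\<close> of a lattice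
    vector, a period of \<open>h\<close>.\<close>
  define H where "H w = h (SOME z. torus_map z = w)" for w
  have H: "H (torus_map z) = h z" for z
  proof -
    have "torus_map (SOME z'. torus_map z' = torus_map z) = torus_map z" by (rule someI) simp
    then obtain l where "l \<in> integer_lattice" "(SOME z'. torus_map z' = torus_map z) = z + (2 * pi) *\<^sub>R l"
      by (rule torus_map_eqD)
    then show ?thesis unfolding H_def using periodic_integer_lattice[of h, OF per] by simp
  qed
  have contT: "continuous_on ?B torus_map"
    unfolding torus_map_def by (intro continuous_intros)
  have cont_h: "continuous_on ?B h" using cont continuous_on_subset by blast
  have "continuous_on (torus_map ` ?B) H"
  \<comment> \<open>The closed graph argument avoids local inverses of \<open>torus_map\<close>: the
    graph of \<open>H\<close> is the image of the compact box under the continuous map taking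
    \<open>z\<close> to \<open>(torus_map z, h z)\<close>.\<close>
  proof (rule continuous_from_closed_graph)
    show "compact (h ` ?B)" by (intro compact_continuous_image cont_h compact_cbox)
    show "H \<in> torus_map ` ?B \<rightarrow> h ` ?B" by (auto simp: H)
    have "(\<lambda>x. (x, H x)) ` torus_map ` ?B = (\<lambda>z. (torus_map z, h z)) ` ?B"
      by (simp add: image_image H)
    moreover have "compact ((\<lambda>z. (torus_map z, h z)) ` ?B)"
      by (intro compact_continuous_image continuous_on_Pair contT cont_h compact_cbox)
    ultimately show "closed ((\<lambda>x. (x, H x)) ` torus_map ` ?B)"
      by (simp add: compact_imp_closed)
  qed
  then obtain p where p: "polynomial_function p" "\<And>w. w \<in> torus_map ` ?B \<Longrightarrow> norm (H w - p w) < e"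
    using Stone_Weierstrass_polynomial_function[of "torus_map ` ?B" H e] e
      compact_continuous_image[OF contT compact_cbox] by blast
  have "real_polynomial_function (Re \<circ> p)" "real_polynomial_function (Im \<circ> p)"
    using p(1) bounded_linear_Re bounded_linear_Im unfolding polynomial_function_def by blast+
  then obtain r s where r: "wiener r (\<lambda>z. complex_of_real (Re (p (torus_map z))))"
    and s: "wiener s (\<lambda>z. complex_of_real (Im (p (torus_map z))))"
    by (auto simp: comp_def dest!: wiener_polynomial_torus_map)
  have "wiener (r + norm \<i> * s) (\<lambda>z. p (torus_map z))"
    using wiener_add[OF r wiener_cmult[OF s, of \<i>]] by (simp add: complex_eq[symmetric])
  moreover have "norm (h z - p (torus_map z)) < e" for z
  proof -
    obtain z' where "z' \<in> ?B" "torus_map z' = torus_map z" by (rule torus_map_box)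
    then show ?thesis using p(2)[of "torus_map z"] H by (metis imageI)
  qed
  ultimately show ?thesis by (rule that)
qed

section \<open>Continuous logarithms and their Fourier coefficients\<close>

lemma exp_eq_one_constant:
  fixes d :: "'a::real_normed_vector \<Rightarrow> complex"
  assumes "continuous_on UNIV d" "\<And>z. exp (d z) = 1"
  shows "d z = d w"
proof -
  have "d constant_on UNIV"
  proof (rule continuous_discrete_range_constant[OF _ assms(1)])
    fix x
    \<comment> \<open>The values of \<open>d\<close> are integer multiples of
      \<open>2 * pi * \<i>\<close>, so distinct ones are uniformly separated; connectedness of the
      domain does the rest.\<close>
    have "2 * pi \<le> norm (d y - d x)" if "d y \<noteq> d x" for y
    proof -
      have "exp (d y) = exp (d x)" using assms(2) by simp
      then obtain n where n: "d y = d x + (of_int (2 * n) * pi) * \<i>" unfolding exp_eq by blast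
      with that have "n \<noteq> 0" by auto
      then have "1 \<le> \<bar>real_of_int n\<bar>" by linarith
      then show ?thesis by (simp add: n norm_mult)
    qed
    then show "\<exists>e>0. \<forall>y. y \<in> UNIV \<and> d y \<noteq> d x \<longrightarrow> e \<le> norm (d y - d x)"
      by (intro exI[of _ "2 * pi"]) auto
  qed (rule connected_UNIV)
  then show ?thesis unfolding constant_on_def by auto
qed

lemma wiener_levy:
  fixes \<phi> :: "real ^ 'd \<Rightarrow> complex"
  assumes \<phi>: "wiener r \<phi>" and nz: "\<And>z. \<phi> z \<noteq> 0" and one: "\<phi> 0 = 1"
  obtains k h s where "k \<in> integer_lattice" "wiener s h" "h 0 = 0"
    "\<And>z. \<phi> z = exp (\<i> * of_real (k \<bullet> z) + h z)"
proof -
  obtain g' where g': "continuous_on UNIV g'" "\<And>z. \<phi> z = exp (g' z)"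
    using continuous_logarithm_on_contractible[OF wiener_continuous[OF \<phi>]
        convex_imp_contractible[OF convex_UNIV]] nz by auto
  \<comment> \<open>The value \<open>g' 0\<close> is a logarithm of 1 but need not be 0; subtracting
    it selects the branch that vanishes at the origin.\<close>
  define g where "g z = g' z - g' 0" for z
  have g: "continuous_on UNIV g" "\<And>z. \<phi> z = exp (g z)" "g 0 = 0"
    using g' one by (auto simp: g_def exp_diff intro!: continuous_intros)
  \<comment> \<open>Periodicity of \<open>\<phi>\<close> makes the increment of its logarithm over
    one period a multiple of \<open>2 * pi * \<i>\<close>, and by continuity the same multiple
    everywhere. The integer is the winding number of \<open>\<phi>\<close> in direction
    \<open>j\<close>.\<close>
  have "\<exists>n::int. \<forall>z. g (z + (2 * pi) *\<^sub>R axis j 1) - g z = of_int (2 * n) * pi * \<i>" for j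
  proof -
    let ?d = "\<lambda>z. g (z + (2 * pi) *\<^sub>R axis j 1) - g z"
    have 1: "exp (?d z) = 1" for z
      using wiener_periodic[OF \<phi>, of z j] nz[of z] g(2) by (simp add: exp_diff)
    have "continuous_on UNIV ?d"
      by (intro continuous_intros continuous_on_compose2[OF g(1)] g(1)) auto
    from exp_eq_one_constant[OF this 1] have const: "?d z = ?d 0" for z .
    obtain n where "?d 0 = 0 + (of_int (2 * n) * pi) * \<i>"
      using 1[of 0] exp_eq[of "?d 0" 0] by auto
    then show ?thesis by (metis const add_0)
  qed
  then obtain n :: "'d \<Rightarrow> int"
    where n: "\<And>j z. g (z + (2 * pi) *\<^sub>R axis j 1) - g z = of_int (2 * n j) * pi * \<i>" by metis
  \<comment> \<open>The vector of winding numbers: the linear function with slope \<open>k\<close>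
    has the same increments as \<open>g\<close>, so the difference is periodic.\<close>
  define k :: "real ^ 'd" where "k = (\<chi> j. of_int (n j))"
  have k: "k \<in> integer_lattice" by (simp add: k_def integer_lattice_def)
  define h where "h z = g z - \<i> * of_real (k \<bullet> z)" for z
  have h_cont: "continuous_on UNIV h" unfolding h_def by (intro continuous_intros g)
  have h_per: "h (z + (2 * pi) *\<^sub>R axis j 1) = h z" for z j
    using n[of z j] by (simp add: h_def inner_add_right inner_axis k_def algebra_simps)
  have "((\<lambda>w. exp w - 1) \<longlongrightarrow> exp 0 - 1) (at (0::complex))" by (intro tendsto_intros)
  then obtain d where d: "d > 0" "\<And>w::complex. w \<noteq> 0 \<Longrightarrow> norm w < d \<Longrightarrow> norm (exp w - 1) < 1/2"
    using LIM_D[of "\<lambda>w. exp w - 1" "exp 0 - 1" "0 :: complex" "1/2"] by auto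
  have d_less: "norm (exp w - 1) < 1/2" if "norm w < d" for w :: complex
    using d(2)[OF _ that] by (cases "w = 0") auto
  \<comment> \<open>The tolerance has two purposes. Below \<open>d\<close>, the function
    \<open>exp (h - Q)\<close> stays within 1/2 of 1, as \<open>wiener_Ln\<close> requires a bound
    less than 1. Below 1, the imaginary part of \<open>h - Q\<close> stays between
    \<open>- pi\<close> and \<open>pi\<close>, so that \<open>Ln\<close> undoes
    \<open>exp\<close>.\<close>
  obtain t Q where Q: "wiener t Q" "\<And>z. norm (h z - Q z) < min d 1"
    using periodic_approx_wiener[OF h_per h_cont, of "min d 1"] d by auto
  have char: "wiener 1 (\<lambda>z. iexp (z \<bullet> - k))"
    using wiener_sum[of "{()}" "\<lambda>_. - k" "\<lambda>_. 1" 1] k by (simp add: integer_lattice_def)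
  \<comment> \<open>This is \<open>exp (h - Q)\<close> written without \<open>h\<close>. The three
    factors are known to lie in the algebra, whereas for \<open>h\<close> this is the goal.\<close>
  define F where "F z = \<phi> z * iexp (z \<bullet> - k) * exp (-1 * Q z)" for z
  have F: "wiener (r * 1 * exp (norm (-1::complex) * t)) F"
    unfolding F_def by (intro wiener_mult wiener_exp wiener_cmult \<phi> char Q)
  have F_eq: "F z = exp (h z - Q z)" for z
    by (simp add: F_def h_def g(2) exp_diff exp_minus exp_add field_simps inner_commute)
  have "norm (F z - 1) \<le> 1/2" for z using d_less[of "h z - Q z"] Q(2)[of z] by (simp add: F_eq)
  then obtain u where u: "wiener u (\<lambda>z. Ln (F z))" using wiener_Ln[OF F] by fastforce
  have "Ln (F z) = h z - Q z" for z
  proof -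
    have "\<bar>Im (h z - Q z)\<bar> < 1" using Q(2)[of z] abs_Im_le_cmod[of "h z - Q z"] by simp
    then show ?thesis unfolding F_eq using pi_gt3 by (intro Ln_exp) auto
  qed
  then have "wiener (t + u) h" using wiener_add[OF Q(1) u] by simp
  moreover have "h 0 = 0" by (simp add: h_def g)
  moreover have "\<phi> z = exp (\<i> * of_real (k \<bullet> z) + h z)" for z by (simp add: h_def g)
  ultimately show ?thesis using that k by blast
qed

lemma wiener_levy_hermitian:
  fixes \<phi> :: "real ^ 'd \<Rightarrow> complex"
  assumes \<phi>: "wiener r \<phi>" and nz: "\<And>z. \<phi> z \<noteq> 0" and one: "\<phi> 0 = 1"
    and herm: "\<And>z. \<phi> (- z) = cnj (\<phi> z)"
  obtains k b where "k \<in> integer_lattice" "b summable_on integer_lattice"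
    "\<And>z. \<phi> z = exp (\<i> * of_real (k \<bullet> z) +
       (\<Sum>\<^sub>\<infinity>x\<in>integer_lattice. of_real (b x) * (iexp (z \<bullet> x) - 1)))"
proof -
  let ?L = "integer_lattice :: (real ^ 'd) set"
  obtain k h s where k: "k \<in> ?L" and h: "wiener s h" "h 0 = 0"
    "\<And>z. \<phi> z = exp (\<i> * of_real (k \<bullet> z) + h z)"
    using wiener_levy[OF \<phi> nz one] by metis
  \<comment> \<open>The exponential of the difference of both sides is 1 by \<open>herm\<close>,
    since the linear term has the same symmetry. Hence the difference is constant, and it vanishes
    at 0.\<close>
  have h_herm: "h (- z) = cnj (h z)" for z
  proof -
    let ?d = "\<lambda>z. h (- z) - cnj (h z)"
    have "continuous_on UNIV h" using wiener_continuous[OF h(1)] .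
    then have "continuous_on UNIV ?d"
      by (intro continuous_on_diff continuous_on_cnj continuous_on_compose2[of UNIV h _ uminus]
          continuous_on_minus continuous_on_id) auto
    moreover have "exp (?d z) = 1" for z
      using herm[of z] by (simp add: h(3) exp_cnj exp_diff exp_add exp_minus divide_inverse)
    ultimately have "?d z = ?d 0" by (rule exp_eq_one_constant)
    then show ?thesis by (simp add: h(2))
  qed
  obtain c where c: "c abs_summable_on ?L"
    "\<And>z. h z = (\<Sum>\<^sub>\<infinity>k\<in>?L. c k * iexp (z \<bullet> k))"
    using h(1) unfolding wiener_def by blast
  \<comment> \<open>Conjugating the coefficients of \<open>h\<close> represents
    \<open>cnj (h (- z))\<close>, which is again \<open>h z\<close>. Averaging the two
    representations leaves the real parts.\<close>
  define b where "b x = Re (c x)" for x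
  have b: "b summable_on ?L"
    unfolding b_def using summable_on_Re[OF abs_summable_summable[OF c(1)]] .
  have h_eq: "h z = (\<Sum>\<^sub>\<infinity>x\<in>?L. of_real (b x) * iexp (z \<bullet> x))" for z
  proof -
    have s: "(\<lambda>k. c k * iexp (z \<bullet> k)) summable_on ?L"
      by (rule abs_summable_summable) (use c(1) in \<open>simp add: norm_mult\<close>)
    have s': "(\<lambda>k. cnj (c k) * iexp (z \<bullet> k)) summable_on ?L"
      by (rule abs_summable_summable) (use c(1) in \<open>simp add: norm_mult\<close>)
    have "cnj (h (- z)) = (\<Sum>\<^sub>\<infinity>k\<in>?L. cnj (c k) * iexp (z \<bullet> k))"
      by (simp add: c(2) exp_cnj flip: infsum_cnj)
    then have "h z + h z = (\<Sum>\<^sub>\<infinity>k\<in>?L. c k * iexp (z \<bullet> k) + cnj (c k) * iexp (z \<bullet> k))"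
      using h_herm[of z] by (simp add: infsum_add[OF s s'] c(2)[of z])
    also have "\<dots> = (\<Sum>\<^sub>\<infinity>k\<in>?L. 2 * (of_real (b k) * iexp (z \<bullet> k)))"
      by (intro infsum_cong) (simp add: b_def ring_distribs[symmetric] complex_add_cnj)
    also have "\<dots> = 2 * (\<Sum>\<^sub>\<infinity>k\<in>?L. of_real (b k) * iexp (z \<bullet> k))"
      by (rule infsum_cmult_right')
    finally show ?thesis by simp
  qed
  have cb: "(\<lambda>x. complex_of_real (b x)) abs_summable_on ?L"
    using b summable_on_iff_abs_summable_on_real[of b] by simp
  \<comment> \<open>As \<open>h 0 = 0\<close>, the coefficients add up to 0; subtracting this zero
    sum term by term produces the compensating \<open>- 1\<close>.\<close>
  have "h z = (\<Sum>\<^sub>\<infinity>x\<in>?L. of_real (b x) * (iexp (z \<bullet> x) - 1))" for z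
  proof -
    have s: "(\<lambda>x. of_real (b x) * iexp (z \<bullet> x)) summable_on ?L"
      by (rule abs_summable_summable) (use cb in \<open>simp add: norm_mult\<close>)
    have "(\<lambda>x. - complex_of_real (b x)) summable_on ?L"
      using abs_summable_summable[OF cb] by (simp add: summable_on_uminus)
    from infsum_add[OF s this]
    have "(\<Sum>\<^sub>\<infinity>x\<in>?L. of_real (b x) * iexp (z \<bullet> x) - of_real (b x)) = h z - h 0"
      by (simp add: h_eq infsum_uminus)
    then show ?thesis by (simp add: right_diff_distrib h(2))
  qed
  then have "\<phi> z = exp (\<i> * of_real (k \<bullet> z) + (\<Sum>\<^sub>\<infinity>x\<in>?L. of_real (b x) * (iexp (z \<bullet> x) - 1)))" for z
    using h(3)[of z] by simp
  from that[OF k b this] show ?thesis .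
qed

section \<open>Discrete measures and signed measures\<close>

text \<open>The push-forward by the identity only exchanges the sigma-algebra of all sets for the
  Borel one. Negative weights are truncated to 0 by \<open>ennreal\<close>.\<close>

definition discrete_measure :: "('a::topological_space \<Rightarrow> real) \<Rightarrow> 'a measure" where
  "discrete_measure c = distr (density (count_space UNIV) (\<lambda>x. ennreal (c x))) borel (\<lambda>x. x)"

lemma sets_discrete_measure [simp, measurable_cong]: "sets (discrete_measure c) = sets borel"
  and space_discrete_measure [simp]: "space (discrete_measure c) = UNIV"
  by (simp_all add: discrete_measure_def)

lemma emeasure_discrete_measure:
  assumes "A \<in> sets borel"
  shows "emeasure (discrete_measure c) A = (\<integral>\<^sup>+x. ennreal (c x) * indicator A x \<partial>count_space UNIV)"
  using assms by (simp add: discrete_measure_def emeasure_distr emeasure_density)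

lemma scale_discrete_measure:
  assumes "0 \<le> l"
  shows "scale_measure (ennreal l) (discrete_measure c) = discrete_measure (\<lambda>x. l * c x)"
proof (rule measure_eqI)
  fix A assume "A \<in> sets (scale_measure (ennreal l) (discrete_measure c))"
  then have A: "A \<in> sets borel" by simp
  show "emeasure (scale_measure (ennreal l) (discrete_measure c)) A = emeasure (discrete_measure (\<lambda>x. l * c x)) A"
    using assms by (simp add: emeasure_discrete_measure[OF A] nn_integral_cmult[symmetric] ennreal_mult' mult.assoc)
qed simp

lemma emeasure_discrete_measure_zero:
  assumes "A \<in> sets borel" "\<And>x. x \<in> A \<Longrightarrow> c x \<le> 0"
  shows "emeasure (discrete_measure c) A = 0"
proof -
  have "(\<lambda>x. ennreal (c x) * indicator A x) = (\<lambda>x. 0)"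
    using assms(2) by (auto simp: fun_eq_iff indicator_def ennreal_neg)
  then show ?thesis by (simp add: emeasure_discrete_measure[OF assms(1)])
qed

lemma integrable_count_space_summable:
  fixes f :: "'a \<Rightarrow> 'b::{banach, second_countable_topology}"
  shows "integrable (count_space A) f \<longleftrightarrow> f abs_summable_on A"
  using abs_summable_equivalent[of f A] by (simp add: Infinite_Set_Sum.abs_summable_on_def)

lemma lebesgue_integral_count_space_infsum:
  fixes f :: "'a \<Rightarrow> 'b::{banach, second_countable_topology}"
  assumes "f abs_summable_on A"
  shows "(\<integral>x. f x \<partial>count_space A) = (\<Sum>\<^sub>\<infinity>x\<in>A. f x)"
  using infsetsum_infsum[of f A] abs_summable_equivalent[of f A] assms by (simp add: infsetsum_def)

lemma discrete_measure_finite: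
  assumes "\<And>x. 0 \<le> c x" "c summable_on UNIV"
  shows "finite_measure (discrete_measure c)"
proof
  have "integrable (count_space UNIV) c"
    unfolding integrable_count_space_summable using assms by simp
  then have "(\<integral>\<^sup>+x. ennreal (c x) \<partial>count_space UNIV) < \<infinity>"
    using assms(1) by (simp add: nn_integral_eq_integral)
  then show "emeasure (discrete_measure c) (space (discrete_measure c)) \<noteq> \<infinity>"
    by (simp add: emeasure_discrete_measure)
qed

lemma abs_summable_mult_bounded:
  fixes f :: "'a \<Rightarrow> complex"
  assumes "\<And>x. 0 \<le> c x" "c summable_on UNIV" "\<And>x. norm (f x) \<le> B"
  shows "(\<lambda>x. of_real (c x) * f x) abs_summable_on UNIV"
proof (rule summable_on_comparison_test)
  show "(\<lambda>x. c x * B) summable_on UNIV" by (rule summable_on_cmult_left[OF assms(2)])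
  show "norm (of_real (c x) * f x) \<le> c x * B" for x
    using assms(1)[of x] assms(3)[of x] by (simp add: norm_mult mult_left_mono)
qed auto

lemma integral_discrete_measure:
  fixes f :: "'a::topological_space \<Rightarrow> complex"
  assumes "\<And>x. 0 \<le> c x" "c summable_on UNIV" "f \<in> borel_measurable borel" "\<And>x. norm (f x) \<le> B"
  shows "(\<integral>x. f x \<partial>discrete_measure c) = (\<Sum>\<^sub>\<infinity>x. of_real (c x) * f x)"
proof -
  have "(\<integral>x. f x \<partial>discrete_measure c) = (\<integral>x. of_real (c x) * f x \<partial>count_space UNIV)"
    unfolding discrete_measure_def using assms(1,3)
    by (simp add: integral_distr integral_density scaleR_conv_of_real)
  also have "\<dots> = (\<Sum>\<^sub>\<infinity>x. of_real (c x) * f x)"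
    by (rule lebesgue_integral_count_space_infsum) (rule abs_summable_mult_bounded[OF assms(1,2,4)])
  finally show ?thesis .
qed

section \<open>Discrete probability laws on the Borel sigma-algebra\<close>

abbreviation borel_pmf :: "'a::topological_space pmf \<Rightarrow> 'a measure" where
  "borel_pmf p \<equiv> discrete_measure (pmf p)"

lemma borel_pmf_distr: "borel_pmf p = distr (measure_pmf p) borel (\<lambda>x. x)"
  by (simp add: discrete_measure_def measure_pmf_eq_density[symmetric])

lemma prob_distribution_borel_pmf: "prob_distribution (borel_pmf p)"
  unfolding prob_distribution_def
  by (simp add: borel_pmf_distr measure_pmf.prob_space_distr)

lemma emeasure_borel_pmf: "A \<in> sets borel \<Longrightarrow> emeasure (borel_pmf p) A = emeasure p A"
  by (simp add: borel_pmf_distr emeasure_distr)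

lemma pmf_summable: "pmf p summable_on UNIV"
  using integrable_pmf[of UNIV p] by (simp add: integrable_count_space_summable)

lemma infsum_pmf: "(\<Sum>\<^sub>\<infinity>x. pmf p x) = 1"
  using lebesgue_integral_count_space_infsum[of "pmf p" UNIV] pmf_summable[of p]
    integral_pmf[of UNIV p] by simp

text \<open>Both integrals are infinite sums, and boundedness of \<open>f\<close> makes the double
  family weighted by the probabilities absolutely summable. The order of summation can therefore be
  exchanged.\<close>

lemma integral_bind_pmf_bounded:
  fixes f :: "'b \<Rightarrow> complex"
  assumes B: "\<And>x. norm (f x) \<le> B"
  shows "(\<integral>x. f x \<partial>bind_pmf p N) = (\<integral>n. (\<integral>x. f x \<partial>N n) \<partial>p)"
proof -
  have E: "(\<integral>x. g x \<partial>measure_pmf q) = (\<Sum>\<^sub>\<infinity>x. of_real (pmf q x) * g x)"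
    if "\<And>x. norm (g x) \<le> C" for g :: "'c \<Rightarrow> complex" and q C
    unfolding measure_pmf_eq_density
    using lebesgue_integral_count_space_infsum[OF abs_summable_mult_bounded[OF pmf_nonneg pmf_summable that]]
    by (simp add: integral_density scaleR_conv_of_real)
  have B0: "0 \<le> B" using B norm_ge_zero order_trans by blast
  have bound: "norm (\<integral>x. f x \<partial>N n) \<le> B" for n
    using integral_norm_bound[of "measure_pmf (N n)" f]
    by (rule order_trans) (use B B0 in \<open>auto intro!: measure_pmf.integral_le_const measure_pmf.integrable_const_bound[where B=B]\<close>)
  define a where "a n x = complex_of_real (pmf p n) * (of_real (pmf (N n) x) * f x)" for n x
  have inner: "(\<lambda>x. of_real (pmf (N n) x) * f x) abs_summable_on UNIV" for n
    by (rule abs_summable_mult_bounded[OF pmf_nonneg pmf_summable B])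
  have le: "(\<Sum>\<^sub>\<infinity>x. norm (of_real (pmf (N n) x) * f x)) \<le> B" for n
  proof -
    have "(\<Sum>\<^sub>\<infinity>x. norm (of_real (pmf (N n) x) * f x)) \<le> (\<Sum>\<^sub>\<infinity>x. pmf (N n) x * B)"
      by (rule infsum_mono[OF inner summable_on_cmult_left[OF pmf_summable]])
        (simp add: norm_mult mult_left_mono B)
    also have "\<dots> = B" by (simp add: infsum_cmult_left' infsum_pmf)
    finally show ?thesis .
  qed
  have a: "(\<lambda>(n, x). a n x) abs_summable_on UNIV \<times> UNIV"
    unfolding Infinite_Sum.abs_summable_on_Sigma_iff
  proof (intro conjI ballI)
    show "(\<lambda>x. case (n, x) of (n, x) \<Rightarrow> a n x) abs_summable_on UNIV" for n
      using inner[of n] by (simp add: a_def norm_mult[of "complex_of_real (pmf p n)"] summable_on_cmult_right)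
    show "(\<lambda>n. \<Sum>\<^sub>\<infinity>x. norm (case (n, x) of (n, x) \<Rightarrow> a n x)) abs_summable_on UNIV"
    proof (rule summable_on_comparison_test)
      show "(\<lambda>n. pmf p n * B) summable_on UNIV" by (rule summable_on_cmult_left[OF pmf_summable])
      show "norm (\<Sum>\<^sub>\<infinity>x. norm (case (n, x) of (n, x) \<Rightarrow> a n x)) \<le> pmf p n * B" for n
        using le[of n] by (simp add: a_def norm_mult[of "complex_of_real (pmf p n)"] infsum_cmult_right'
            infsum_nonneg mult_left_mono abs_mult)
    qed auto
  qed
  have "(\<integral>x. f x \<partial>bind_pmf p N) = (\<Sum>\<^sub>\<infinity>x. of_real (pmf (bind_pmf p N) x) * f x)"
    by (rule E[OF B])
  also have "\<dots> = (\<Sum>\<^sub>\<infinity>x. \<Sum>\<^sub>\<infinity>n. a n x)"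
  proof (rule infsum_cong)
    fix x
    have "complex_of_real (pmf (bind_pmf p N) x) = (\<integral>n. complex_of_real (pmf (N n) x) \<partial>p)"
      by (simp add: pmf_bind)
    also have "\<dots> = (\<Sum>\<^sub>\<infinity>n. of_real (pmf p n) * of_real (pmf (N n) x))"
      by (rule E[of _ 1]) (simp add: pmf_le_1)
    finally show "of_real (pmf (bind_pmf p N) x) * f x = (\<Sum>\<^sub>\<infinity>n. a n x)"
      by (simp add: a_def mult.assoc[symmetric] infsum_cmult_left')
  qed
  also have "\<dots> = (\<Sum>\<^sub>\<infinity>n. \<Sum>\<^sub>\<infinity>x. a n x)"
    by (rule infsum_swap_banach[symmetric]) (rule abs_summable_summable[OF a])
  also have "\<dots> = (\<Sum>\<^sub>\<infinity>n. of_real (pmf p n) * (\<integral>x. f x \<partial>N n))"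
    unfolding a_def by (simp add: infsum_cmult_right' E[OF B])
  also have "\<dots> = (\<integral>n. (\<integral>x. f x \<partial>N n) \<partial>p)"
    by (rule E[OF bound, symmetric])
  finally show ?thesis .
qed

lemma char_fun_borel_pmf: "char_fun (borel_pmf p) z = (\<integral>x. iexp (z \<bullet> x) \<partial>measure_pmf p)"
  by (simp add: char_fun_def borel_pmf_distr integral_distr)

lemma char_fun_borel_pmf_infsum:
  "char_fun (borel_pmf p) z = (\<Sum>\<^sub>\<infinity>x. of_real (pmf p x) * iexp (z \<bullet> x))"
  unfolding char_fun_def
  by (rule integral_discrete_measure[OF pmf_nonneg pmf_summable, of _ 1]) simp_all

lemma embed_pmf_summable:
  assumes c: "\<And>x. 0 \<le> c x" "c summable_on UNIV" "(\<Sum>\<^sub>\<infinity>x. c x) = 1"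
  obtains p where "pmf p = c"
proof
  have "integrable (count_space UNIV) c" "(\<integral>x. c x \<partial>count_space UNIV) = 1"
    using c lebesgue_integral_count_space_infsum[of c UNIV] by (simp_all add: integrable_count_space_summable)
  then have "(\<integral>\<^sup>+x. ennreal (c x) \<partial>count_space UNIV) = 1"
    using c(1) by (simp add: nn_integral_eq_integral)
  then show "pmf (embed_pmf c) = c" using c(1) by (auto simp: pmf_embed_pmf)
qed

text \<open>Up to a null set, every Borel set is its trace on \<open>L\<close>, which is a countable
  union of singletons. Hence the point masses determine the measure.\<close>

lemma prob_distribution_countable:
  fixes \<mu> :: "'a::t1_space measure"
  assumes \<mu>: "prob_distribution \<mu>" and L: "countable L" "AE x in \<mu>. x \<in> L"
  obtains p where "\<mu> = borel_pmf p" "set_pmf p \<subseteq> L"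
proof -
  interpret prob_space \<mu> using \<mu> by (simp add: prob_distribution_def)
  have sets_\<mu> [simp]: "sets \<mu> = sets borel" using \<mu> by (simp add: prob_distribution_def)
  have space_\<mu> [simp]: "space \<mu> = UNIV" using sets_eq_imp_space_eq[OF sets_\<mu>] by simp
  have borelI: "A \<in> sets borel" if "A \<subseteq> L" for A
    using that L(1) countable_subset sets.countable[of A borel] by auto
  have restr: "emeasure \<mu> A = emeasure \<mu> (A \<inter> L)" if "A \<in> sets borel" for A
    by (rule emeasure_eq_AE) (use that L(2) borelI[of "A \<inter> L"] in auto)
  have sing: "emeasure \<mu> A = (\<integral>\<^sup>+x. emeasure \<mu> {x} \<partial>count_space A)" if "A \<subseteq> L" for A
    by (rule emeasure_countable_singleton) (use that L(1) countable_subset in auto)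
  have out: "emeasure \<mu> {x} = 0" if "x \<notin> L" for x
    using restr[of "{x}"] that by simp
  have "(\<integral>\<^sup>+x. emeasure \<mu> {x} \<partial>count_space UNIV) = (\<integral>\<^sup>+x. emeasure \<mu> {x} \<partial>count_space L)"
    by (rule nn_integral_count_space_eq) (use out in auto)
  also have "\<dots> = 1"
    using sing[of L] restr[of UNIV] emeasure_space_1 by simp
  finally have one: "(\<integral>\<^sup>+x. ennreal (measure \<mu> {x}) \<partial>count_space UNIV) = 1"
    by (simp add: emeasure_eq_measure)
  define p where "p = embed_pmf (\<lambda>x. measure \<mu> {x})"
  have pmf_p: "pmf p x = measure \<mu> {x}" for x
    unfolding p_def using one by (subst pmf_embed_pmf) auto
  have set_p: "set_pmf p \<subseteq> L"
  proof
    fix x assume "x \<in> set_pmf p"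
    then have "emeasure \<mu> {x} \<noteq> 0" by (auto simp: set_pmf_iff pmf_p measure_def)
    then show "x \<in> L" using out by blast
  qed
  show ?thesis
  proof
    show "\<mu> = borel_pmf p"
    proof (rule measure_eqI)
      fix A assume "A \<in> sets \<mu>"
      then have A: "A \<in> sets borel" by simp
      have "emeasure \<mu> A = (\<integral>\<^sup>+x. emeasure p {x} \<partial>count_space (A \<inter> L))"
        using restr[OF A] sing[of "A \<inter> L"] by (simp add: emeasure_pmf_single pmf_p emeasure_eq_measure)
      also have "\<dots> = emeasure p (A \<inter> L)"
        by (rule emeasure_countable_singleton[symmetric]) (use L(1) in auto)
      also have "\<dots> = emeasure p A"
        by (rule emeasure_eq_AE) (use set_p in \<open>auto simp: AE_measure_pmf_iff\<close>)
      finally show "emeasure \<mu> A = emeasure (borel_pmf p) A" by (simp add: emeasure_borel_pmf A)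
    qed simp
  qed (rule set_p)
qed

section \<open>Jordan decompositions, supports and the topology of the lattice\<close>

lemma positive_part_eq:
  assumes "finite_measure M" "finite_measure N" and [simp]: "sets M = sets borel" "sets N = sets borel"
    and Y: "Y \<in> sets borel" "emeasure M (- Y) = 0" "emeasure N Y = 0"
  shows "positive_part (\<lambda>A. measure M A - measure N A) = M"
proof -
  interpret M: finite_measure M by fact
  interpret N: finite_measure N by fact
  have sp: "space M = UNIV" using sets_eq_imp_space_eq[of M borel] by simp
  have eq: "(SUP B\<in>{B \<in> sets borel. B \<subseteq> A}. ennreal (measure M B - measure N B)) = emeasure M A"
    if A: "A \<in> sets borel" for A
  proof (rule antisym)
    show "(SUP B\<in>{B \<in> sets borel. B \<subseteq> A}. ennreal (measure M B - measure N B)) \<le> emeasure M A"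
    proof (rule SUP_least)
      fix B assume B: "B \<in> {B \<in> sets borel. B \<subseteq> A}"
      have "ennreal (measure M B - measure N B) \<le> ennreal (measure M B)"
        by (intro ennreal_leI) simp
      also have "\<dots> = emeasure M B" by (simp add: M.emeasure_eq_measure)
      also have "\<dots> \<le> emeasure M A" by (rule emeasure_mono) (use A B in auto)
      finally show "ennreal (measure M B - measure N B) \<le> emeasure M A" .
    qed
    \<comment> \<open>\<open>Y\<close> is a Hahn set: \<open>M\<close> is concentrated on it and
      \<open>N\<close> on its complement. The supremum over the Borel subsets of \<open>A\<close> is
      thus attained at \<open>A \<inter> Y\<close>.\<close>
    have "emeasure M A = emeasure M (A \<inter> Y)"
    proof (rule emeasure_eq_AE)
      have "- Y \<in> null_sets M" using Y by (simp add: null_sets_def)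
      then have "AE x in M. x \<notin> - Y" by (rule AE_not_in)
      then show "AE x in M. (x \<in> A) = (x \<in> A \<inter> Y)" by auto
    qed (use A Y in auto)
    moreover have "emeasure N (A \<inter> Y) = 0"
      using emeasure_mono[of "A \<inter> Y" Y N] Y by simp
    ultimately have "emeasure M A = ennreal (measure M (A \<inter> Y) - measure N (A \<inter> Y))"
      by (simp add: M.emeasure_eq_measure measure_def[of N])
    also have "\<dots> \<le> (SUP B\<in>{B \<in> sets borel. B \<subseteq> A}. ennreal (measure M B - measure N B))"
      by (rule SUP_upper) (use A Y in auto)
    finally show "emeasure M A \<le> (SUP B\<in>{B \<in> sets borel. B \<subseteq> A}. ennreal (measure M B - measure N B))" .
  qed
  have "positive_part (\<lambda>A. measure M A - measure N A) = measure_of UNIV (sets borel) (emeasure M)"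
    unfolding positive_part_def
    by (rule measure_of_eq) (use eq sets.sigma_sets_eq[of borel] in auto)
  also have "\<dots> = measure_of (space M) (sets M) (emeasure M)" by (simp add: sp)
  also have "\<dots> = M" by (rule measure_of_of_measure)
  finally show ?thesis .
qed

lemma finite_signed_measure_diff:
  assumes "finite_measure M" "finite_measure N" "sets M = sets borel" "sets N = sets borel"
  shows "finite_signed_measure (\<lambda>A. measure M A - measure N A)"
  unfolding finite_signed_measure_def
  using assms by (auto intro!: sums_diff finite_measure.finite_measure_UNION)

lemma measure_support_subset:
  assumes "closed S" "emeasure M (- S) = 0"
  shows "measure_support M \<subseteq> S"
proof
  fix x assume x: "x \<in> measure_support M"
  show "x \<in> S"
  proof (rule ccontr)
    assume "x \<notin> S"
    then have "emeasure M (- S) > 0"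
      using x open_Compl[OF assms(1)] by (simp add: measure_support_def)
    then show False using assms(2) by simp
  qed
qed

lemma total_variation_null:
  assumes "emeasure (positive_part \<nu>) A = 0" "emeasure (negative_part \<nu>) A = 0"
  shows "emeasure (total_variation \<nu>) A = 0"
  using assms by (simp add: total_variation_def emeasure_measure_of_conv)

lemma closed_integer_lattice: "closed (integer_lattice :: (real ^ 'd) set)"
proof -
  have eq: "integer_lattice = (\<Inter>i. (\<lambda>x :: real ^ 'd. x $ i) -` \<int>)"
    by (auto simp: integer_lattice_def)
  show ?thesis
    unfolding eq by (intro closed_INT ballI closed_vimage closed_Ints continuous_intros)
qed

text \<open>A null complement confines the support only if the set is closed. Removing the origin
  keeps the lattice closed because all other lattice points have norm at least 1.\<close>

lemma closed_integer_lattice_nonzero: "closed (integer_lattice - {0} :: (real ^ 'd) set)"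
proof -
  have "1 \<le> norm x" if "x \<in> integer_lattice" "x \<noteq> 0" for x :: "real ^ 'd"
  proof -
    obtain i where i: "x $ i \<noteq> 0" using \<open>x \<noteq> 0\<close> by (auto simp: vec_eq_iff)
    have "x $ i \<in> \<int>" using that by (simp add: integer_lattice_def)
    then have "1 \<le> \<bar>x $ i\<bar>" using i by (rule Ints_nonzero_abs_ge1)
    also have "\<dots> \<le> norm x" by (rule component_le_norm_cart)
    finally show ?thesis .
  qed
  then have "integer_lattice - {0} = integer_lattice \<inter> {x :: real ^ 'd. 1 \<le> norm x}" by auto
  moreover have "closed {x :: real ^ 'd. 1 \<le> norm x}" by (intro closed_Collect_le continuous_intros)
  ultimately show ?thesis using closed_Int[OF closed_integer_lattice] by metis
qed

lemma countable_integer_lattice: "countable (integer_lattice :: (real ^ 'd) set)"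
proof -
  have "integer_lattice \<subseteq> range (\<lambda>m. \<chi> j :: 'd. real_of_int (m j))"
  proof
    fix x :: "real ^ 'd" assume "x \<in> integer_lattice"
    then have "\<forall>j. \<exists>m::int. x $ j = of_int m" by (auto simp: integer_lattice_def Ints_def)
    then obtain m :: "'d \<Rightarrow> int" where m: "\<And>j. x $ j = of_int (m j)" by (auto dest: choice)
    then have "x = (\<chi> j. real_of_int (m j))" by (simp add: vec_eq_iff)
    then show "x \<in> range (\<lambda>m. \<chi> j :: 'd. real_of_int (m j))" by blast
  qed
  then show ?thesis by (rule countable_subset) simp
qed

section \<open>Characteristic functions and infinite divisibility\<close>

lemma prob_distribution_finite: "prob_distribution M \<Longrightarrow> finite_measure M"
  by (simp add: prob_distribution_def prob_space_def)

lemma prob_distribution_convolution: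
  assumes "prob_distribution M" "prob_distribution N"
  shows "prob_distribution (M \<star> N)"
proof -
  have [measurable_cong]: "sets M = sets borel" "sets N = sets borel"
    using assms by (auto simp: prob_distribution_def)
  interpret pair_prob_space M N
    using assms by (auto simp: prob_distribution_def pair_prob_space_def pair_sigma_finite_def
        prob_space_imp_sigma_finite)
  show ?thesis
    unfolding prob_distribution_def convolution_def by (auto intro!: prob_space_distr)
qed

lemma integrable_char:
  fixes M :: "'a::euclidean_space measure"
  assumes "prob_distribution M" shows "integrable M (\<lambda>x. iexp (z \<bullet> x))"
proof -
  interpret prob_space M using assms by (simp add: prob_distribution_def)
  have [measurable_cong]: "sets M = sets borel" using assms by (simp add: prob_distribution_def)
  show ?thesis by (rule integrable_const_bound[where B = 1]) auto
qed

lemma char_fun_convolution: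
  assumes "prob_distribution M" "prob_distribution N"
  shows "char_fun (M \<star> N) z = char_fun M z * char_fun N z"
proof -
  have [measurable_cong]: "sets M = sets borel" "sets N = sets borel"
    using assms by (auto simp: prob_distribution_def)
  interpret pair_prob_space M N
    using assms by (auto simp: prob_distribution_def pair_prob_space_def pair_sigma_finite_def
        prob_space_imp_sigma_finite)
  have "char_fun (M \<star> N) z = (\<integral>p. iexp (z \<bullet> (fst p + snd p)) \<partial>(M \<Otimes>\<^sub>M N))"
    unfolding char_fun_def convolution_def by (subst integral_distr) (auto simp: case_prod_beta)
  also have "\<dots> = (\<integral>x. (\<integral>y. iexp (z \<bullet> (x + y)) \<partial>N) \<partial>M)"
  proof -
    have "integrable (M \<Otimes>\<^sub>M N) (\<lambda>p. iexp (z \<bullet> (fst p + snd p)))"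
      by (rule P.integrable_const_bound[where B = 1]) auto
    from integral_fst'[OF this] show ?thesis by simp
  qed
  also have "\<dots> = char_fun M z * char_fun N z"
    by (simp add: char_fun_def inner_add_right ring_distribs exp_add)
  finally show ?thesis .
qed

text \<open>The two claims share one induction, since multiplicativity in the successor step
  requires the shorter power to be a probability distribution.\<close>

lemma conv_power_prob_char:
  assumes "prob_distribution M"
  shows "prob_distribution (conv_power M n) \<and> char_fun (conv_power M n) z = char_fun M z ^ n"
proof (induction n)
  case 0
  have "prob_distribution (return borel (0 :: 'a))"
    by (simp add: prob_distribution_def prob_space_return)
  moreover have "char_fun (return borel (0 :: 'a)) z = 1"
    unfolding char_fun_def by (subst integral_return) auto
  ultimately show ?case by simp
next
  case (Suc n)
  then show ?case using assms by (simp add: prob_distribution_convolution char_fun_convolution)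
qed

lemma char_fun_norm_le: "prob_distribution M \<Longrightarrow> norm (char_fun M z) \<le> 1"
proof -
  assume M: "prob_distribution M"
  then interpret prob_space M by (simp add: prob_distribution_def)
  have "norm (char_fun M z) \<le> (\<integral>x. norm (iexp (z \<bullet> x)) \<partial>M)"
    unfolding char_fun_def by (rule integral_norm_bound)
  then show ?thesis by (simp add: prob_space)
qed

section \<open>Zeros of characteristic functions\<close>

text \<open>Applied to the symmetrization of $M$, whose characteristic function is
  $|\widehat M|^2$, the inequality $1 - \cos 2u \le 4 (1 - \cos u)$ gives the claim.\<close>

lemma char_fun_double:
  fixes M :: "'a::ordered_euclidean_space measure"
  assumes M: "prob_distribution M"
  shows "1 - (norm (char_fun M (2 *\<^sub>R z)))\<^sup>2 \<le> 4 * (1 - (norm (char_fun M z))\<^sup>2)"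
proof -
  define N where "N = distr M borel (\<lambda>x. - x)"
  interpret M: prob_space M using M by (simp add: prob_distribution_def)
  have [measurable_cong, simp]: "sets M = sets borel" using M by (simp add: prob_distribution_def)
  have N: "prob_distribution N"
    unfolding N_def prob_distribution_def by (auto intro!: M.prob_space_distr)
  have char_N: "char_fun N z = cnj (char_fun M z)" for z
  proof -
    have "char_fun N z = (\<integral>x. cnj (iexp (z \<bullet> x)) \<partial>M)"
      unfolding char_fun_def N_def by (subst integral_distr) (auto simp: exp_cnj)
    also have "\<dots> = cnj (char_fun M z)" unfolding char_fun_def by (rule Bochner_Integration.integral_cnj)
    finally show ?thesis .
  qed
  define S where "S = (M \<star> N)"
  have S: "prob_distribution S" unfolding S_def by (rule prob_distribution_convolution[OF M N])
  interpret S: prob_space S using S by (simp add: prob_distribution_def)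
  have [measurable_cong, simp]: "sets S = sets borel" using S by (simp add: prob_distribution_def)
  have int: "integrable S (\<lambda>x. cos (w \<bullet> x))" for w
    by (rule S.integrable_const_bound[where B = 1]) auto
  have sq: "(norm (char_fun M w))\<^sup>2 = (\<integral>x. cos (w \<bullet> x) \<partial>S)" for w
  proof -
    have "complex_of_real ((norm (char_fun M w))\<^sup>2) = char_fun S w"
      unfolding S_def char_fun_convolution[OF M N] char_N by (rule complex_norm_square)
    then have "(norm (char_fun M w))\<^sup>2 = Re (char_fun S w)" by (metis Re_complex_of_real)
    also have "\<dots> = (\<integral>x. Re (iexp (w \<bullet> x)) \<partial>S)"
      unfolding char_fun_def by (rule integral_Re[symmetric]) (rule integrable_char[OF S])
    also have "\<dots> = (\<integral>x. cos (w \<bullet> x) \<partial>S)" by (simp add: Re_exp)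
    finally show ?thesis .
  qed
  have cos: "1 - cos (2 * u) \<le> 4 * (1 - cos u)" for u :: real
  proof -
    have "4 * (1 - cos u) - (1 - cos (2 * u)) = 2 * (1 - cos u)\<^sup>2"
      using cos_double_cos[of u] by (simp add: power2_eq_square algebra_simps)
    then show ?thesis using zero_le_power2[of "1 - cos u"] by linarith
  qed
  have "1 - (norm (char_fun M (2 *\<^sub>R z)))\<^sup>2 = (\<integral>x. 1 - cos (2 * (z \<bullet> x)) \<partial>S)"
    using int[of "2 *\<^sub>R z"] by (simp add: sq S.prob_space)
  also have "\<dots> \<le> (\<integral>x. 4 * (1 - cos (z \<bullet> x)) \<partial>S)"
    using int[of "2 *\<^sub>R z"] int[of z] cos by (intro integral_mono) auto
  also have "\<dots> = 4 * (1 - (norm (char_fun M z))\<^sup>2)"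
    using int[of z] by (simp add: sq S.prob_space)
  finally show ?thesis .
qed

lemma char_fun_tendsto_1:
  assumes M: "prob_distribution M"
  shows "(\<lambda>m. char_fun M ((1/2) ^ m *\<^sub>R z)) \<longlonglongrightarrow> 1"
proof -
  interpret prob_space M using M by (simp add: prob_distribution_def)
  have [measurable_cong, simp]: "sets M = sets borel" using M by (simp add: prob_distribution_def)
  have "(\<lambda>m. (CLINT x|M. iexp ((1/2) ^ m * (z \<bullet> x)))) \<longlonglongrightarrow> (CLINT x|M. 1)"
  proof (rule integral_dominated_convergence[where w = "\<lambda>_. 1"])
    have "(\<lambda>m. iexp ((1/2) ^ m * u)) \<longlonglongrightarrow> iexp (0 * u)" for u
      by (intro tendsto_intros LIMSEQ_power_zero) auto
    then show "AE x in M. (\<lambda>m. iexp ((1/2) ^ m * (z \<bullet> x))) \<longlonglongrightarrow> 1" by simp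
  qed auto
  then show ?thesis by (simp add: char_fun_def prob_space)
qed

text \<open>Suppose there is a zero at \<open>z\<close>. By continuity at 0, the characteristic
  function has some modulus \<open>a > 0\<close> at \<open>z\<close> divided by
  \<open>2 ^ m\<close>, for a fixed \<open>m\<close>. A convolution root of order \<open>n\<close>
  still vanishes at \<open>z\<close>, but has modulus \<open>root n a\<close> at the smaller
  argument. Applying \<open>char_fun_double\<close> \<open>m\<close> times yields
  \<open>1 \<le> 4 ^ m * (1 - (root n a)\<^sup>2)\<close>, whose right side tends to 0 as
  \<open>n\<close> grows.\<close>

lemma infinitely_divisible_char_nonzero:
  assumes "infinitely_divisible \<mu>" shows "char_fun \<mu> z \<noteq> 0"
proof
  assume z0: "char_fun \<mu> z = 0"
  have \<mu>: "prob_distribution \<mu>" using assms by (simp add: infinitely_divisible_def)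
  have "\<forall>\<^sub>F m in sequentially. char_fun \<mu> ((1/2) ^ m *\<^sub>R z) \<noteq> 0"
    by (rule tendsto_imp_eventually_ne[OF char_fun_tendsto_1[OF \<mu>]]) simp
  then obtain m where m: "char_fun \<mu> ((1/2) ^ m *\<^sub>R z) \<noteq> 0"
    by (auto simp: eventually_sequentially)
  define w where "w = (1/2) ^ m *\<^sub>R z"
  define a where "a = norm (char_fun \<mu> w)"
  have a: "a > 0" using m by (simp add: a_def w_def)
  have z_eq: "z = 2 ^ m *\<^sub>R w" by (simp add: w_def power_one_over)
  have "1 \<le> 4 ^ m * (1 - (root n a)\<^sup>2)" if n: "n \<ge> 1" for n
  proof -
    obtain M where M: "prob_distribution M" "\<mu> = conv_power M n"
      using assms n by (auto simp: infinitely_divisible_def)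
    have char: "char_fun \<mu> u = char_fun M u ^ n" for u
      using conv_power_prob_char[OF M(1)] M(2) by simp
    have iter: "1 - (norm (char_fun M (2 ^ j *\<^sub>R u)))\<^sup>2 \<le> 4 ^ j * (1 - (norm (char_fun M u))\<^sup>2)" for j u
    proof (induction j)
      case (Suc j)
      have "1 - (norm (char_fun M (2 ^ Suc j *\<^sub>R u)))\<^sup>2 \<le> 4 * (1 - (norm (char_fun M (2 ^ j *\<^sub>R u)))\<^sup>2)"
        using char_fun_double[OF M(1), of "2 ^ j *\<^sub>R u"] by simp
      also have "\<dots> \<le> 4 * (4 ^ j * (1 - (norm (char_fun M u))\<^sup>2))" using Suc by simp
      finally show ?case by simp
    qed simp
    have "char_fun M z = 0" using char[of z] z0 n by simp
    moreover have "norm (char_fun M w) = root n a"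
      unfolding a_def char norm_power using n by (simp add: real_root_power_cancel)
    ultimately show ?thesis using iter[of m w] z_eq by simp
  qed
  moreover have "(\<lambda>n. 4 ^ m * (1 - (root n a)\<^sup>2)) \<longlonglongrightarrow> 4 ^ m * (1 - 1\<^sup>2)"
    by (intro tendsto_intros LIMSEQ_root_const a)
  ultimately have "1 \<le> 4 ^ m * (1 - 1\<^sup>2 :: real)"
    by (intro LIMSEQ_le_const[where X = "\<lambda>n. 4 ^ m * (1 - (root n a)\<^sup>2)"]) blast+
  then show False by simp
qed

text \<open>The difference of the two mass functions has a vanishing Fourier series, so a finite
  part of the series is minus its tail and is uniformly small. The bound
  \<open>trig_poly_coeff_le\<close>, valid for arbitrary real frequencies, then makes each
  coefficient of the finite part small.\<close>

lemma char_fun_pmf_unique: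
  fixes p q :: "'a::euclidean_space pmf"
  assumes eq: "\<And>z. char_fun (borel_pmf p) z = char_fun (borel_pmf q) z"
  shows "p = q"
proof (rule pmf_eqI)
  fix m
  define c where "c x = complex_of_real (pmf p x) - of_real (pmf q x)" for x
  have s: "(\<lambda>x. of_real (pmf p x) * iexp (z \<bullet> x)) abs_summable_on UNIV"
    for z :: 'a and p :: "'a pmf"
    by (rule abs_summable_mult_bounded[OF pmf_nonneg pmf_summable, of _ 1]) simp
  have c: "c abs_summable_on UNIV"
  proof (rule summable_on_comparison_test)
    show "(\<lambda>x. pmf p x + pmf q x) summable_on UNIV" by (intro summable_on_add pmf_summable)
    show "norm (c x) \<le> pmf p x + pmf q x" for x
      using norm_triangle_ineq4[of "complex_of_real (pmf p x)" "complex_of_real (pmf q x)"]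
      by (simp add: c_def)
  qed auto
  have "norm (c m) \<le> e" if e: "e > 0" for e
  proof -
    obtain F where F: "finite F" "dist (\<Sum>x\<in>F. norm (c x)) (\<Sum>\<^sub>\<infinity>x. norm (c x)) \<le> e"
      using infsum_finite_approximation[OF c e] by blast
    \<comment> \<open>The coefficient under study has to belong to the finite part; enlarging that
      part only shrinks the tail.\<close>
    let ?F = "insert m F"
    have split: "infsum g UNIV = (\<Sum>x\<in>?F. g x) + infsum g (- ?F)" if "g summable_on UNIV"
      for g :: "'a \<Rightarrow> 'b::banach"
    proof -
      have "infsum g (?F \<union> - ?F) = infsum g ?F + infsum g (- ?F)"
        using F(1) by (intro infsum_Un_disjoint summable_on_subset_banach[OF that]) auto
      then show ?thesis using F by simp
    qed
    have tail: "(\<Sum>\<^sub>\<infinity>x\<in>- ?F. norm (c x)) \<le> e"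
    proof -
      have "(\<Sum>x\<in>F. norm (c x)) \<le> (\<Sum>x\<in>?F. norm (c x))"
        by (rule sum_mono2) (use F in auto)
      then show ?thesis using F(2) split[OF c] by (simp only: dist_real_def)
    qed
    show ?thesis
    proof (rule trig_poly_coeff_le[of ?F])
      fix z
      have cz: "(\<lambda>x. c x * iexp (z \<bullet> x)) abs_summable_on UNIV" using c by (simp add: norm_mult)
      have "(\<Sum>\<^sub>\<infinity>x. c x * iexp (z \<bullet> x)) =
          (\<Sum>\<^sub>\<infinity>x. of_real (pmf p x) * iexp (z \<bullet> x) + - (of_real (pmf q x) * iexp (z \<bullet> x)))"
        by (simp add: c_def left_diff_distrib)
      also have "\<dots> = char_fun (borel_pmf p) z - char_fun (borel_pmf q) z"
        unfolding char_fun_borel_pmf_infsum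
        by (subst infsum_add) (auto simp: infsum_uminus summable_on_uminus intro: abs_summable_summable[OF s])
      finally have "(\<Sum>x\<in>?F. c x * iexp (z \<bullet> x)) = - (\<Sum>\<^sub>\<infinity>x\<in>- ?F. c x * iexp (z \<bullet> x))"
        using split[OF abs_summable_summable[OF cz]] eq[of z] by (simp add: eq_neg_iff_add_eq_0)
      then have "norm (\<Sum>x\<in>?F. c x * iexp (z \<bullet> x)) = norm (\<Sum>\<^sub>\<infinity>x\<in>- ?F. c x * iexp (z \<bullet> x))"
        by simp
      also have "\<dots> \<le> (\<Sum>\<^sub>\<infinity>x\<in>- ?F. norm (c x * iexp (z \<bullet> x)))"
        by (rule norm_infsum_bound) (rule summable_on_subset_banach[OF cz subset_UNIV])
      also have "\<dots> \<le> e" using tail by (simp add: norm_mult)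
      finally show "norm (\<Sum>x\<in>?F. c x * iexp (z \<bullet> x)) \<le> e" .
    qed (use F in auto)
  qed
  then have "norm (c m) \<le> 0" by (rule field_le_epsilon[of _ 0, simplified])
  then show "pmf p m = pmf q m" by (simp add: c_def)
qed

section \<open>Convolutions of discrete laws and Poisson mixtures\<close>

definition add_pmf :: "'a::plus pmf \<Rightarrow> 'a pmf \<Rightarrow> 'a pmf" where
  "add_pmf p q = bind_pmf p (\<lambda>x. map_pmf ((+) x) q)"

lemma convolution_borel_pmf:
  fixes p q :: "'a::ordered_euclidean_space pmf"
  shows "(borel_pmf p \<star> borel_pmf q) = borel_pmf (add_pmf p q)"
proof (rule measure_eqI)
  fix A :: "'a set" assume "A \<in> sets (borel_pmf p \<star> borel_pmf q)"
  then have A [measurable]: "A \<in> sets borel" by simp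
  note fin = prob_distribution_finite[OF prob_distribution_borel_pmf]
  interpret q: finite_measure "borel_pmf q" by (rule fin)
  have inner: "(\<integral>\<^sup>+y. indicator A (x + y) \<partial>borel_pmf q) = (\<integral>\<^sup>+y. indicator A (x + y) \<partial>measure_pmf q)" for x
    unfolding borel_pmf_distr by (subst nn_integral_distr) auto
  have meas: "(\<lambda>x. \<integral>\<^sup>+y. indicator A (x + y) \<partial>borel_pmf q) \<in> borel_measurable borel"
    by measurable
  have "emeasure (borel_pmf p \<star> borel_pmf q) A =
      (\<integral>\<^sup>+x. \<integral>\<^sup>+y. indicator A (x + y) \<partial>borel_pmf q \<partial>borel_pmf p)"
    by (rule convolution_emeasure') (use A fin in auto)
  also have "\<dots> = (\<integral>\<^sup>+x. \<integral>\<^sup>+y. indicator A (x + y) \<partial>borel_pmf q \<partial>measure_pmf p)"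
    unfolding borel_pmf_distr[of p] using meas by (subst nn_integral_distr) auto
  also have "\<dots> = (\<integral>\<^sup>+x. indicator A x \<partial>measure_pmf (add_pmf p q))"
    by (simp add: inner add_pmf_def del: nn_integral_indicator)
  also have "\<dots> = emeasure (borel_pmf (add_pmf p q)) A"
    by (simp add: emeasure_borel_pmf)
  finally show "emeasure (borel_pmf p \<star> borel_pmf q) A = emeasure (borel_pmf (add_pmf p q)) A" .
qed simp

primrec sum_pmf :: "'a::{plus, zero} pmf \<Rightarrow> nat \<Rightarrow> 'a pmf" where
  "sum_pmf p 0 = return_pmf 0"
| "sum_pmf p (Suc n) = add_pmf p (sum_pmf p n)"

lemma conv_power_borel_pmf:
  fixes p :: "'a::ordered_euclidean_space pmf"
  shows "conv_power (borel_pmf p) n = borel_pmf (sum_pmf p n)"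
proof (induction n)
  case 0
  have "return borel (0 :: 'a) = borel_pmf (return_pmf 0)"
    by (rule measure_eqI) (auto simp: emeasure_borel_pmf)
  then show ?case by (simp only: conv_power.simps sum_pmf.simps)
next
  case (Suc n) then show ?case by (simp add: convolution_borel_pmf)
qed

lemma char_fun_sum_pmf:
  fixes p :: "'a::ordered_euclidean_space pmf"
  shows "char_fun (borel_pmf (sum_pmf p n)) z = char_fun (borel_pmf p) z ^ n"
  using conv_power_prob_char[OF prob_distribution_borel_pmf, of p n] by (simp add: conv_power_borel_pmf)

text \<open>The probability generating function of the Poisson law. The argument is complex because
  a characteristic function will be inserted for it.\<close>

lemma poisson_char:
  fixes w :: complex
  assumes l: "0 < l" and w: "norm w \<le> 1"
  shows "(\<integral>n. w ^ n \<partial>measure_pmf (poisson_pmf l)) = exp (of_real l * (w - 1))"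
proof -
  have bound: "norm (w ^ n) \<le> 1" for n using w by (simp add: norm_power power_le_one)
  have as: "(\<lambda>n. of_real (pmf (poisson_pmf l) n) * w ^ n) abs_summable_on UNIV"
    by (rule abs_summable_mult_bounded[OF pmf_nonneg pmf_summable bound])
  have "(\<integral>n. w ^ n \<partial>measure_pmf (poisson_pmf l)) = (\<Sum>\<^sub>\<infinity>n. of_real (pmf (poisson_pmf l) n) * w ^ n)"
    unfolding measure_pmf_eq_density
    using lebesgue_integral_count_space_infsum[OF as] by (simp add: integral_density scaleR_conv_of_real)
  also have "\<dots> = (\<Sum>n. of_real (pmf (poisson_pmf l) n) * w ^ n)"
    using has_sum_imp_sums[OF has_sum_infsum[OF abs_summable_summable[OF as]]] by (simp add: sums_iff)
  also have "\<dots> = exp (of_real l * (w - 1))"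
  proof (rule sums_unique[symmetric])
    have "(\<lambda>n. (of_real l * w) ^ n /\<^sub>R fact n * exp (- of_real l)) sums (exp (of_real l * w) * exp (- of_real l))"
      by (intro sums_mult2 exp_converges)
    also have "(\<lambda>n. (of_real l * w) ^ n /\<^sub>R fact n * exp (- of_real l)) =
        (\<lambda>n. of_real (pmf (poisson_pmf l) n) * w ^ n)"
      using l by (simp add: fun_eq_iff power_mult_distrib scaleR_conv_of_real exp_of_real[symmetric] field_simps)
    also have "exp (of_real l * w) * exp (- of_real l) = exp (of_real l * (w - 1))"
      by (simp add: exp_add[symmetric] algebra_simps)
    finally show "(\<lambda>n. of_real (pmf (poisson_pmf l) n) * w ^ n) sums exp (of_real l * (w - 1))" .
  qed
  finally show ?thesis .
qed

text \<open>The law is that of \<open>k\<close> plus a sum of independent variables with law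
  \<open>p\<close>, their number being Poisson with mean \<open>l\<close>. The translation
  \<open>k\<close> provides the factor that the quotient in (iv) must absorb.\<close>

lemma compound_poisson_pmf_exists:
  fixes p :: "'a::ordered_euclidean_space pmf"
  assumes l: "0 < l"
  obtains q where "\<And>z. char_fun (borel_pmf q) z =
    iexp (k \<bullet> z) * exp (of_real l * (char_fun (borel_pmf p) z - 1))"
proof
  let ?q = "bind_pmf (poisson_pmf l) (sum_pmf p)"
  fix z
  have q: "char_fun (borel_pmf ?q) z = exp (of_real l * (char_fun (borel_pmf p) z - 1))"
  proof -
    have "char_fun (borel_pmf ?q) z = (\<integral>n. (\<integral>x. iexp (z \<bullet> x) \<partial>sum_pmf p n) \<partial>poisson_pmf l)"
      unfolding char_fun_borel_pmf by (rule integral_bind_pmf_bounded[of _ 1]) simp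
    also have "\<dots> = (\<integral>n. char_fun (borel_pmf p) z ^ n \<partial>poisson_pmf l)"
      by (simp add: char_fun_borel_pmf[symmetric] char_fun_sum_pmf)
    also have "\<dots> = exp (of_real l * (char_fun (borel_pmf p) z - 1))"
      by (rule poisson_char[OF l char_fun_norm_le[OF prob_distribution_borel_pmf]])
    finally show ?thesis .
  qed
  have "char_fun (borel_pmf (map_pmf ((+) k) ?q)) z = iexp (k \<bullet> z) * char_fun (borel_pmf ?q) z"
    by (simp add: char_fun_borel_pmf inner_add_right ring_distribs exp_add inner_commute[of k z])
  then show "char_fun (borel_pmf (map_pmf ((+) k) ?q)) z =
      iexp (k \<bullet> z) * exp (of_real l * (char_fun (borel_pmf p) z - 1))"
    unfolding q .
qed

text \<open>The convolution root of order \<open>n\<close> is the same construction with rate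
  \<open>l / n\<close> and translation \<open>k /\<^sub>R n\<close>. It may charge points off the
  lattice, so the laws here live on the whole space.\<close>

lemma infinitely_divisible_borel_pmf:
  fixes p q :: "'a::ordered_euclidean_space pmf"
  assumes l: "0 < l" and q: "\<And>z. char_fun (borel_pmf q) z =
    iexp (k \<bullet> z) * exp (of_real l * (char_fun (borel_pmf p) z - 1))"
  shows "infinitely_divisible (borel_pmf q)"
  unfolding infinitely_divisible_def
proof (intro conjI allI impI)
  fix n :: nat assume n: "n \<ge> 1"
  obtain r where r: "\<And>z. char_fun (borel_pmf r) z =
      iexp ((k /\<^sub>R n) \<bullet> z) * exp (of_real (l / n) * (char_fun (borel_pmf p) z - 1))"
    by (rule compound_poisson_pmf_exists[of "l / n" "k /\<^sub>R n" p]) (use l n in auto)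
  have "char_fun (borel_pmf (sum_pmf r n)) z = char_fun (borel_pmf q) z" for z
  proof -
    have 1: "of_nat n * (of_real (l / n) * w) = of_real l * w" for w :: complex
      using n by simp
    have 2: "of_nat n * (\<i> * complex_of_real ((k /\<^sub>R n) \<bullet> z)) = \<i> * of_real (k \<bullet> z)"
      using n by simp
    show ?thesis
      by (simp only: char_fun_sum_pmf r q power_mult_distrib exp_of_nat_mult[symmetric] 1 2)
  qed
  then have "q = sum_pmf r n" using char_fun_pmf_unique by metis
  then show "\<exists>\<mu>\<^sub>n. prob_distribution \<mu>\<^sub>n \<and> borel_pmf q = conv_power \<mu>\<^sub>n n"
    using prob_distribution_borel_pmf conv_power_borel_pmf by metis
qed (rule prob_distribution_borel_pmf)

section \<open>The equivalence\<close>

lemma wiener_char_fun: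
  fixes p :: "(real ^ 'd) pmf"
  assumes "set_pmf p \<subseteq> integer_lattice"
  shows "wiener 1 (char_fun (borel_pmf p))"
proof (rule wiener_family[of "\<lambda>x. of_real (pmf p x)" integer_lattice "\<lambda>x. x"])
  have zero: "pmf p x = 0" if "x \<notin> integer_lattice" for x
    using assms that by (auto simp: set_pmf_iff)
  show "(\<lambda>x. complex_of_real (pmf p x)) abs_summable_on integer_lattice"
    using summable_on_subset_banach[OF pmf_summable[of p]] by simp
  have "(\<Sum>\<^sub>\<infinity>x\<in>integer_lattice. norm (complex_of_real (pmf p x))) = (\<Sum>\<^sub>\<infinity>x. pmf p x)"
    by (rule infsum_cong_neutral) (auto simp: zero)
  then show "(\<Sum>\<^sub>\<infinity>x\<in>integer_lattice. norm (complex_of_real (pmf p x))) \<le> 1"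
    by (simp add: infsum_pmf)
  show "char_fun (borel_pmf p) z = (\<Sum>\<^sub>\<infinity>x\<in>integer_lattice. of_real (pmf p x) * iexp (z \<bullet> x))" for z
    unfolding char_fun_borel_pmf_infsum by (rule infsum_cong_neutral) (auto simp: zero)
qed simp

lemma char_fun_uminus:
  "char_fun M (- z) = cnj (char_fun M z)"
proof -
  have "char_fun M (- z) = (CLINT x|M. cnj (iexp (z \<bullet> x)))"
    by (simp add: char_fun_def exp_cnj)
  then show ?thesis unfolding char_fun_def by (simp only: Bochner_Integration.integral_cnj)
qed

lemma lattice_char_fun_nonzero_exponent:
  fixes p :: "(real ^ 'd) pmf"
  assumes p: "set_pmf p \<subseteq> integer_lattice" and nz: "\<And>z. char_fun (borel_pmf p) z \<noteq> 0"
  obtains k b where "k \<in> integer_lattice" "b summable_on UNIV"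
    "\<And>x. x \<notin> integer_lattice - {0} \<Longrightarrow> b x = 0"
    "\<And>z. char_fun (borel_pmf p) z = exp (\<i> * of_real (k \<bullet> z) +
       (\<Sum>\<^sub>\<infinity>x. of_real (b x) * (iexp (z \<bullet> x) - 1)))"
proof -
  let ?\<phi> = "char_fun (borel_pmf p)"
  have one: "?\<phi> 0 = 1" by (simp add: char_fun_borel_pmf)
  obtain k b where k: "k \<in> integer_lattice" and b: "b summable_on integer_lattice"
    and eq: "\<And>z. ?\<phi> z = exp (\<i> * of_real (k \<bullet> z) +
       (\<Sum>\<^sub>\<infinity>x\<in>integer_lattice. of_real (b x) * (iexp (z \<bullet> x) - 1)))"
    using wiener_levy_hermitian[OF wiener_char_fun[OF p] nz one char_fun_uminus] by blast
  \<comment> \<open>The coefficient at 0 can be changed to 0 because it is multiplied by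
    \<open>iexp (z \<bullet> 0) - 1\<close>, which is 0.\<close>
  define b' where "b' x = (if x \<in> integer_lattice - {0} then b x else 0)" for x
  show ?thesis
  proof (rule that[OF k])
    have "b summable_on integer_lattice - {0}"
      using b by (rule summable_on_subset_banach) auto
    then show "b' summable_on UNIV"
      by (rule summable_on_cong_neutral[THEN iffD1, rotated -1]) (auto simp: b'_def)
    show "b' x = 0" if "x \<notin> integer_lattice - {0}" for x
      using that unfolding b'_def by (rule if_not_P)
    show "?\<phi> z = exp (\<i> * of_real (k \<bullet> z) + (\<Sum>\<^sub>\<infinity>x. of_real (b' x) * (iexp (z \<bullet> x) - 1)))" for z
      unfolding eq
      by (intro arg_cong[of _ _ exp] arg_cong[of _ _ "(+) _"] infsum_cong_neutral) (auto simp: b'_def)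
  qed
qed

section \<open>Measures built from the coefficients of the exponent\<close>

lemma discrete_measure_lattice_null:
  assumes "\<And>x. x \<notin> integer_lattice - {0} \<Longrightarrow> c x = 0"
  shows "emeasure (discrete_measure c) (- (integer_lattice - {0} :: (real ^ 'd) set)) = 0"
proof (rule emeasure_discrete_measure_zero)
  show "- (integer_lattice - {0} :: (real ^ 'd) set) \<in> sets borel"
    by (intro borel_open open_Compl closed_integer_lattice_nonzero)
qed (metis ComplD assms order_refl)

lemma norm_iexp_diff_one_le: "norm (iexp x - 1) \<le> 2"
  using norm_triangle_ineq4[of "iexp x" 1] by simp

lemma infsum_diff_iexp:
  assumes c: "\<And>x. 0 \<le> c x" "c summable_on UNIV" and d: "\<And>x. 0 \<le> d x" "d summable_on UNIV"
    and b: "\<And>x. b x = c x - d x"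
  shows "(\<Sum>\<^sub>\<infinity>x. of_real (b x) * (iexp (z \<bullet> x) - 1)) =
    (\<Sum>\<^sub>\<infinity>x. of_real (c x) * (iexp (z \<bullet> x) - 1)) - (\<Sum>\<^sub>\<infinity>x. of_real (d x) * (iexp (z \<bullet> x) - 1))"
proof -
  let ?f = "\<lambda>x. iexp (z \<bullet> x) - 1"
  have sc: "(\<lambda>x. of_real (c x) * ?f x) summable_on UNIV"
    by (rule abs_summable_summable, rule abs_summable_mult_bounded[OF c norm_iexp_diff_one_le])
  have sd: "(\<lambda>x. of_real (d x) * ?f x) summable_on UNIV"
    by (rule abs_summable_summable, rule abs_summable_mult_bounded[OF d norm_iexp_diff_one_le])
  have "(\<Sum>\<^sub>\<infinity>x. of_real (b x) * ?f x) = (\<Sum>\<^sub>\<infinity>x. of_real (c x) * ?f x + - (of_real (d x) * ?f x))"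
    by (rule infsum_cong) (simp add: b left_diff_distrib)
  also have "\<dots> = (\<Sum>\<^sub>\<infinity>x. of_real (c x) * ?f x) - (\<Sum>\<^sub>\<infinity>x. of_real (d x) * ?f x)"
    using sd by (subst infsum_add[OF sc]) (auto simp: summable_on_uminus infsum_uminus)
  finally show ?thesis .
qed

lemma signed_measure_of_coefficients:
  fixes b :: "real ^ 'd \<Rightarrow> real"
  assumes b: "b summable_on UNIV" and b0: "\<And>x. x \<notin> integer_lattice - {0} \<Longrightarrow> b x = 0"
  obtains \<nu> where "finite_signed_measure \<nu>" "signed_support \<nu> \<subseteq> integer_lattice - {0}"
    "\<And>z. signed_integral \<nu> (\<lambda>x. iexp (z \<bullet> x) - 1) = (\<Sum>\<^sub>\<infinity>x. of_real (b x) * (iexp (z \<bullet> x) - 1))"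
proof -
  let ?L = "integer_lattice - {0} :: (real ^ 'd) set"
  define c d where "c x = max (b x) 0" and "d x = max (- b x) 0" for x
  have abs_b: "(\<lambda>x. \<bar>b x\<bar>) summable_on UNIV"
    using b summable_on_iff_abs_summable_on_real[of b] by simp
  have c: "c summable_on UNIV" and d: "d summable_on UNIV"
    by (rule summable_on_comparison_test[OF abs_b]; simp add: c_def d_def)+
  have c0: "0 \<le> c x" and d0: "0 \<le> d x" for x by (simp_all add: c_def d_def)
  have c_L: "c x = 0" and d_L: "d x = 0" if "x \<notin> ?L" for x using b0[OF that] by (simp_all add: c_def d_def)
  define M N where "M = discrete_measure c" and "N = discrete_measure d"
  have fin: "finite_measure M" "finite_measure N"
    unfolding M_def N_def by (auto intro!: discrete_measure_finite c d c0 d0)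
  have sets: "sets M = sets borel" "sets N = sets borel" by (simp_all add: M_def N_def)
  \<comment> \<open>A Hahn set for the signed measure: \<open>d\<close> vanishes on it and
    \<open>c\<close> off it. It is Borel because it consists of countably many lattice
    points.\<close>
  define Y where "Y = {x. 0 < b x}"
  have "Y \<subseteq> integer_lattice" using b0 by (force simp: Y_def)
  then have Y: "Y \<in> sets borel"
    using countable_integer_lattice countable_subset sets.countable[of Y borel] by auto
  have null: "emeasure M (- Y) = 0" "emeasure N (- (- Y)) = 0" "emeasure N Y = 0"
    unfolding M_def N_def using Y
    by (auto intro!: emeasure_discrete_measure_zero simp: c_def d_def Y_def)
  define \<nu> where "\<nu> A = measure M A - measure N A" for A
  have pos: "positive_part \<nu> = M"
    unfolding \<nu>_def[abs_def] by (rule positive_part_eq[OF fin sets Y null(1,3)])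
  have neg: "negative_part \<nu> = N"
    unfolding negative_part_def \<nu>_def minus_diff_eq
    by (rule positive_part_eq[OF fin(2,1) sets(2,1), of "- Y"]) (use Y null in auto)
  show ?thesis
  proof
    show "finite_signed_measure \<nu>"
      unfolding \<nu>_def[abs_def] by (rule finite_signed_measure_diff[OF fin sets])
    show "signed_support \<nu> \<subseteq> ?L"
      unfolding signed_support_def
      by (intro measure_support_subset closed_integer_lattice_nonzero total_variation_null;
          unfold pos neg M_def N_def; intro discrete_measure_lattice_null c_L d_L)
    fix z :: "real ^ 'd"
    let ?f = "\<lambda>x. iexp (z \<bullet> x) - 1"
    have meas: "?f \<in> borel_measurable borel" by measurable
    have "signed_integral \<nu> ?f = (\<Sum>\<^sub>\<infinity>x. of_real (c x) * ?f x) - (\<Sum>\<^sub>\<infinity>x. of_real (d x) * ?f x)"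
      unfolding signed_integral_def pos neg M_def N_def
      by (simp only: integral_discrete_measure[OF c0 c meas norm_iexp_diff_one_le]
          integral_discrete_measure[OF d0 d meas norm_iexp_diff_one_le])
    also have "\<dots> = (\<Sum>\<^sub>\<infinity>x. of_real (b x) * ?f x)"
      by (rule infsum_diff_iexp[OF c0 c d0 d, symmetric]) (simp add: c_def d_def)
    finally show "signed_integral \<nu> ?f = (\<Sum>\<^sub>\<infinity>x. of_real (b x) * ?f x)" .
  qed
qed

text \<open>The rate is the total mass of \<open>c\<close> and the jump law is \<open>c\<close>
  normalised; the point \<open>e\<close> guarantees that this mass is positive. The second law is
  the translate by \<open>k\<close>, supplied for use in (iv).\<close>

lemma compound_poisson_of_coefficients:
  fixes c :: "real ^ 'd \<Rightarrow> real" and k :: "real ^ 'd"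
  assumes c: "c summable_on UNIV" and c0: "\<And>x. 0 \<le> c x"
    and c_L: "\<And>x. x \<notin> integer_lattice - {0} \<Longrightarrow> c x = 0" and e: "0 < c e"
  obtains \<mu> \<sigma> \<mu>' :: "(real ^ 'd) measure" where
    "compound_poisson \<mu> \<sigma>" "measure_support \<sigma> \<subseteq> integer_lattice - {0}" "infinitely_divisible \<mu>"
    "\<And>z. char_fun \<mu> z = exp (\<Sum>\<^sub>\<infinity>x. of_real (c x) * (iexp (z \<bullet> x) - 1))"
    "infinitely_divisible \<mu>'" "\<And>z. char_fun \<mu>' z = iexp (k \<bullet> z) * char_fun \<mu> z"
proof -
  let ?L = "integer_lattice - {0} :: (real ^ 'd) set"
  define l where "l = (\<Sum>\<^sub>\<infinity>x. c x)"
  have "c e \<le> l"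
    using finite_sum_le_infsum[OF c, of "{e}"] c0 by (simp add: l_def)
  then have l: "0 < l" using e by simp
  have "(\<lambda>x. c x / l) summable_on UNIV" "(\<Sum>\<^sub>\<infinity>x. c x / l) = 1"
    using c l by (simp_all add: divide_inverse summable_on_cmult_left infsum_cmult_left' l_def[symmetric])
  then obtain p where p: "pmf p = (\<lambda>x. c x / l)"
    using embed_pmf_summable[of "\<lambda>x. c x / l"] c0 l by auto
  have exponent: "(CLINT x|scale_measure (ennreal l) (borel_pmf p). iexp (z \<bullet> x) - 1) =
      (\<Sum>\<^sub>\<infinity>x. of_real (c x) * (iexp (z \<bullet> x) - 1))" for z
  proof -
    have "scale_measure (ennreal l) (borel_pmf p) = discrete_measure c"
      using l by (simp add: scale_discrete_measure p)
    moreover have "(\<lambda>x. iexp (z \<bullet> x) - 1) \<in> borel_measurable borel" by measurable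
    ultimately show ?thesis
      using integral_discrete_measure[OF c0 c _ norm_iexp_diff_one_le] by simp
  qed
  \<comment> \<open>The exponent occurs in two shapes: as the integral against the scaled jump law
    in \<open>compound_poisson\<close>, and in the closed form delivered by the Poisson mixture.
    Both equal the same series.\<close>
  have exponent': "of_real l * (char_fun (borel_pmf p) z - 1) = (\<Sum>\<^sub>\<infinity>x. of_real (c x) * (iexp (z \<bullet> x) - 1))" for z
  proof -
    have A: "(\<lambda>x. of_real (pmf p x) * iexp (z \<bullet> x)) abs_summable_on UNIV"
      by (rule abs_summable_mult_bounded[OF pmf_nonneg pmf_summable, of _ 1]) simp
    have B: "(\<lambda>x. of_real (pmf p x) * - 1 :: complex) abs_summable_on UNIV"
      by (rule abs_summable_mult_bounded[OF pmf_nonneg pmf_summable, of _ 1]) simp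
    have "((\<lambda>x. complex_of_real (pmf p x)) has_sum of_real 1) UNIV"
      using has_sum_infsum[OF pmf_summable[of p]] unfolding infsum_pmf by (rule has_sum_of_real)
    then have "(\<Sum>\<^sub>\<infinity>x. of_real (pmf p x) * - 1 :: complex) = - 1"
      by (simp add: infsum_uminus infsumI)
    then have "char_fun (borel_pmf p) z - 1 = (\<Sum>\<^sub>\<infinity>x. of_real (pmf p x) * iexp (z \<bullet> x) + of_real (pmf p x) * - 1)"
      unfolding char_fun_borel_pmf_infsum
      by (subst infsum_add[OF abs_summable_summable[OF A] abs_summable_summable[OF B]]) simp
    then have "of_real l * (char_fun (borel_pmf p) z - 1) =
        (\<Sum>\<^sub>\<infinity>x. of_real l * (of_real (pmf p x) * iexp (z \<bullet> x) + of_real (pmf p x) * - 1))"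
      by (simp only: infsum_cmult_right')
    also have "\<dots> = (\<Sum>\<^sub>\<infinity>x. of_real (c x) * (iexp (z \<bullet> x) - 1))"
      by (rule infsum_cong) (use l in \<open>simp add: p field_simps\<close>)
    finally show ?thesis .
  qed
  obtain q where q: "\<And>z. char_fun (borel_pmf q) z =
      iexp (0 \<bullet> z) * exp (of_real l * (char_fun (borel_pmf p) z - 1))"
    using compound_poisson_pmf_exists[OF l, where k = 0 and p = p] by blast
  obtain q' where q': "\<And>z. char_fun (borel_pmf q') z =
      iexp (k \<bullet> z) * exp (of_real l * (char_fun (borel_pmf p) z - 1))"
    using compound_poisson_pmf_exists[OF l, where k = k and p = p] by blast
  have p_L: "pmf p x = 0" if "x \<notin> ?L" for x using c_L[OF that] by (simp add: p)
  show ?thesis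
  proof
    show "compound_poisson (borel_pmf q) (borel_pmf p)"
      unfolding compound_poisson_def
    proof (intro conjI exI allI prob_distribution_borel_pmf)
      show "emeasure (borel_pmf p) {0} = 0"
        by (rule emeasure_discrete_measure_zero) (auto simp: p_L)
      show "char_fun (borel_pmf q) z = exp (CLINT x|scale_measure (ennreal l) (borel_pmf p). iexp (z \<bullet> x) - 1)" for z
        by (simp add: q exponent exponent')
    qed (rule l)
    show "measure_support (borel_pmf p) \<subseteq> ?L"
      by (intro measure_support_subset closed_integer_lattice_nonzero discrete_measure_lattice_null p_L)
    show "infinitely_divisible (borel_pmf q)" by (rule infinitely_divisible_borel_pmf[OF l q])
    show "infinitely_divisible (borel_pmf q')" by (rule infinitely_divisible_borel_pmf[OF l q'])
    show "char_fun (borel_pmf q) z = exp (\<Sum>\<^sub>\<infinity>x. of_real (c x) * (iexp (z \<bullet> x) - 1))" for z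
      by (simp add: q exponent')
    show "char_fun (borel_pmf q') z = iexp (k \<bullet> z) * char_fun (borel_pmf q) z" for z
      by (simp add: q q')
  qed
qed

lemma compound_poisson_char_nonzero: "compound_poisson \<mu> \<sigma> \<Longrightarrow> char_fun \<mu> z \<noteq> 0"
  unfolding compound_poisson_def by (metis exp_not_eq_zero)

text \<open>The pair \<mu>1, \<mu>2 serves (iii). For (iv), which has no separate exponential
  factor, the numerator is replaced by the translate \<open>\<mu>\<^sub>3\<close> over the same
  denominator.\<close>

lemma compound_poisson_quotient_of_coefficients:
  fixes b :: "real ^ 'd \<Rightarrow> real" and k :: "real ^ 'd"
  assumes b: "b summable_on UNIV" and b0: "\<And>x. x \<notin> integer_lattice - {0} \<Longrightarrow> b x = 0"
  obtains \<mu>\<^sub>1 \<mu>\<^sub>2 \<sigma>\<^sub>1 \<sigma>\<^sub>2 \<mu>\<^sub>3 :: "(real ^ 'd) measure" where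
    "compound_poisson \<mu>\<^sub>1 \<sigma>\<^sub>1" "measure_support \<sigma>\<^sub>1 \<subseteq> integer_lattice - {0}"
    "compound_poisson \<mu>\<^sub>2 \<sigma>\<^sub>2" "measure_support \<sigma>\<^sub>2 \<subseteq> integer_lattice - {0}"
    "infinitely_divisible \<mu>\<^sub>2" "infinitely_divisible \<mu>\<^sub>3"
    "\<And>z. char_fun \<mu>\<^sub>3 z = iexp (k \<bullet> z) * char_fun \<mu>\<^sub>1 z"
    "\<And>z. exp (\<Sum>\<^sub>\<infinity>x. of_real (b x) * (iexp (z \<bullet> x) - 1)) = char_fun \<mu>\<^sub>1 z / char_fun \<mu>\<^sub>2 z"
proof -
  let ?L = "integer_lattice - {0} :: (real ^ 'd) set"
  \<comment> \<open>Any nonzero lattice point would do; \<open>undefined\<close> is just some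
    coordinate index, one of which exists in every dimension type.\<close>
  define e :: "real ^ 'd" where "e = axis undefined 1"
  have e: "e \<in> ?L" by (simp add: e_def integer_lattice_def axis_def vec_eq_iff)
  \<comment> \<open>A common unit atom makes both jump measures nonzero and cancels in the quotient.\<close>
  define \<delta> where "\<delta> x = (if x = e then 1 else 0 :: real)" for x
  define c d where "c x = max (b x) 0 + \<delta> x" and "d x = max (- b x) 0 + \<delta> x" for x
  have "(\<lambda>x. \<bar>b x\<bar>) summable_on UNIV"
    using b summable_on_iff_abs_summable_on_real[of b] by simp
  moreover have "\<delta> summable_on UNIV"
    by (rule finite_nonzero_values_imp_summable_on) (simp add: \<delta>_def)
  ultimately have abs_b: "(\<lambda>x. \<bar>b x\<bar> + \<delta> x) summable_on UNIV" by (rule summable_on_add)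
  have c: "c summable_on UNIV" and d: "d summable_on UNIV"
    by (rule summable_on_comparison_test[OF abs_b]; simp add: c_def d_def \<delta>_def)+
  have c0: "0 \<le> c x" and d0: "0 \<le> d x" for x by (simp_all add: c_def d_def \<delta>_def)
  have c_L: "c x = 0" and d_L: "d x = 0" if "x \<notin> ?L" for x
    using b0[OF that] e that by (auto simp: c_def d_def \<delta>_def)
  have ce: "0 < c e" and de: "0 < d e" by (simp_all add: c_def d_def \<delta>_def add_nonneg_pos)
  obtain \<mu>\<^sub>1 \<sigma>\<^sub>1 \<mu>\<^sub>3 where 1: "compound_poisson \<mu>\<^sub>1 \<sigma>\<^sub>1" "measure_support \<sigma>\<^sub>1 \<subseteq> ?L"
    "infinitely_divisible \<mu>\<^sub>1" "\<And>z. char_fun \<mu>\<^sub>1 z = exp (\<Sum>\<^sub>\<infinity>x. of_real (c x) * (iexp (z \<bullet> x) - 1))"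
    "infinitely_divisible \<mu>\<^sub>3" "\<And>z. char_fun \<mu>\<^sub>3 z = iexp (k \<bullet> z) * char_fun \<mu>\<^sub>1 z"
    by (rule compound_poisson_of_coefficients[OF c c0 c_L ce, of k]; (assumption | (rule that; blast)))
  obtain \<mu>\<^sub>2 \<sigma>\<^sub>2 \<mu>\<^sub>4 where 2: "compound_poisson \<mu>\<^sub>2 \<sigma>\<^sub>2" "measure_support \<sigma>\<^sub>2 \<subseteq> ?L"
    "infinitely_divisible \<mu>\<^sub>2" "\<And>z. char_fun \<mu>\<^sub>2 z = exp (\<Sum>\<^sub>\<infinity>x. of_real (d x) * (iexp (z \<bullet> x) - 1))"
    "infinitely_divisible \<mu>\<^sub>4" "\<And>z. char_fun \<mu>\<^sub>4 z = iexp (0 \<bullet> z) * char_fun \<mu>\<^sub>2 z"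
    by (rule compound_poisson_of_coefficients[OF d d0 d_L de, of 0]; (assumption | (rule that; blast)))
  have "exp (\<Sum>\<^sub>\<infinity>x. of_real (b x) * (iexp (z \<bullet> x) - 1)) = char_fun \<mu>\<^sub>1 z / char_fun \<mu>\<^sub>2 z" for z
    by (subst infsum_diff_iexp[OF c0 c d0 d]) (simp_all add: c_def d_def 1(4) 2(4) exp_diff)
  from that[OF 1(1,2) 2(1,2,3) 1(5,6) this] show ?thesis .
qed

theorem theorem3p2:
  fixes \<mu> :: "(real ^ 'd) measure"
  assumes "prob_distribution \<mu>"
    and "AE x in \<mu>. x \<in> integer_lattice"
  shows
    "((\<forall>z. char_fun \<mu> z \<noteq> 0) \<longleftrightarrow>
       (\<exists>k\<in>integer_lattice. \<exists>\<nu> :: (real ^ 'd) set \<Rightarrow> real.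
          finite_signed_measure \<nu> \<and> signed_support \<nu> \<subseteq> integer_lattice - {0} \<and>
          (\<forall>z. char_fun \<mu> z =
             exp (\<i> * complex_of_real (k \<bullet> z) + signed_integral \<nu> (\<lambda>x. iexp (z \<bullet> x) - 1)))))
     \<and> ((\<forall>z. char_fun \<mu> z \<noteq> 0) \<longleftrightarrow>
       (\<exists>k\<in>integer_lattice. \<exists>\<mu>\<^sub>1 \<mu>\<^sub>2 \<sigma>\<^sub>1 \<sigma>\<^sub>2 :: (real ^ 'd) measure.
          compound_poisson \<mu>\<^sub>1 \<sigma>\<^sub>1 \<and> measure_support \<sigma>\<^sub>1 \<subseteq> integer_lattice - {0} \<and>
          compound_poisson \<mu>\<^sub>2 \<sigma>\<^sub>2 \<and> measure_support \<sigma>\<^sub>2 \<subseteq> integer_lattice - {0} \<and>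
          (\<forall>z. char_fun \<mu> z = iexp (k \<bullet> z) * (char_fun \<mu>\<^sub>1 z / char_fun \<mu>\<^sub>2 z))))
     \<and> ((\<forall>z. char_fun \<mu> z \<noteq> 0) \<longleftrightarrow>
       (\<exists>\<mu>\<^sub>3 \<mu>\<^sub>4 :: (real ^ 'd) measure.
          infinitely_divisible \<mu>\<^sub>3 \<and> infinitely_divisible \<mu>\<^sub>4 \<and>
          (\<forall>z. char_fun \<mu> z = char_fun \<mu>\<^sub>3 z / char_fun \<mu>\<^sub>4 z)))"
    (is "(?i \<longleftrightarrow> ?ii) \<and> (?i \<longleftrightarrow> ?iii) \<and> (?i \<longleftrightarrow> ?iv)")
proof -
  have "?ii \<and> ?iii \<and> ?iv" if nz: ?i
  proof -
    \<comment> \<open>Concentration on the countable lattice turns the measure into a mass function,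
      whose characteristic function is an absolutely convergent Fourier series.\<close>
    obtain p where p: "\<mu> = borel_pmf p" "set_pmf p \<subseteq> integer_lattice"
      using prob_distribution_countable[OF assms(1) countable_integer_lattice assms(2)] by blast
    have nz': "char_fun (borel_pmf p) z \<noteq> 0" for z using nz p(1) by simp
    obtain k b where k: "k \<in> integer_lattice" and b: "b summable_on UNIV"
      "\<And>x. x \<notin> integer_lattice - {0} \<Longrightarrow> b x = 0"
      and eq: "\<And>z. char_fun \<mu> z = exp (\<i> * of_real (k \<bullet> z) +
         (\<Sum>\<^sub>\<infinity>x. of_real (b x) * (iexp (z \<bullet> x) - 1)))"
      by (rule lattice_char_fun_nonzero_exponent[OF p(2) nz']) (rule that; simp add: p(1))
    obtain \<nu> where "finite_signed_measure \<nu>" "signed_support \<nu> \<subseteq> integer_lattice - {0}"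
      "\<And>z. signed_integral \<nu> (\<lambda>x. iexp (z \<bullet> x) - 1) = (\<Sum>\<^sub>\<infinity>x. of_real (b x) * (iexp (z \<bullet> x) - 1))"
      by (rule signed_measure_of_coefficients[OF b]; (assumption | (rule that; blast)))
    then have ii: ?ii using k eq by (intro bexI[of _ k] exI[of _ \<nu>]) simp_all
    obtain \<mu>\<^sub>1 \<mu>\<^sub>2 \<sigma>\<^sub>1 \<sigma>\<^sub>2 \<mu>\<^sub>3 :: "(real ^ 'd) measure" where
      cp: "compound_poisson \<mu>\<^sub>1 \<sigma>\<^sub>1" "measure_support \<sigma>\<^sub>1 \<subseteq> integer_lattice - {0}"
      "compound_poisson \<mu>\<^sub>2 \<sigma>\<^sub>2" "measure_support \<sigma>\<^sub>2 \<subseteq> integer_lattice - {0}"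
      and id: "infinitely_divisible \<mu>\<^sub>2" "infinitely_divisible \<mu>\<^sub>3"
      "\<And>z. char_fun \<mu>\<^sub>3 z = iexp (k \<bullet> z) * char_fun \<mu>\<^sub>1 z"
      and q: "\<And>z. exp (\<Sum>\<^sub>\<infinity>x. of_real (b x) * (iexp (z \<bullet> x) - 1)) = char_fun \<mu>\<^sub>1 z / char_fun \<mu>\<^sub>2 z"
      by (rule compound_poisson_quotient_of_coefficients[OF b, of k]; (assumption | (rule that; blast)))
    have quot: "char_fun \<mu> z = iexp (k \<bullet> z) * (char_fun \<mu>\<^sub>1 z / char_fun \<mu>\<^sub>2 z)" for z
      unfolding eq exp_add q ..
    have ?iii using k cp quot by blast
    moreover have "char_fun \<mu> z = char_fun \<mu>\<^sub>3 z / char_fun \<mu>\<^sub>2 z" for z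
      using quot[of z] id(3)[of z] by simp
    then have ?iv using id(1,2) by blast
    ultimately show ?thesis using ii by blast
  qed
  moreover have ?i if ?ii
    using that by (metis exp_not_eq_zero)
  \<comment> \<open>Division by zero yields 0, so the quotient is nonzero only if the denominator is
    nonzero as well as the numerator. The same applies to (iv).\<close>
  moreover have ?i if ?iii
    using that compound_poisson_char_nonzero by (metis divide_eq_0_iff exp_not_eq_zero mult_eq_0_iff)
  moreover have ?i if ?iv
    using that infinitely_divisible_char_nonzero by (metis divide_eq_0_iff)
  ultimately show ?thesis by blast
qed

end
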